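(* Consider $$u_t=\frac1{m+1}(u^{m+1})_{xx}+u^p(1-u^2)(u^2-a^2)\qquad(\mathrm{E})$$ with $m=3/4$, $p=1/4$, $a=0.3$. Then there exist $c_\ast\in[-5.0\times10^{-7},5.0\times10^{-7}]$ and finite values $\xi_{\min}<\xi_{\max}$ such that $u(t,x)=\phi(x-c_\ast t)$ with $$\phi(\xi)=\begin{cases}\varphi(\xi)&\xi\in(\xi_{\min},\xi_{\max}),\\0&\xi\in\mathbb{R}\setminus(\xi_{\min},\xi_{\max})\end{cases}$$ is a compacton traveling wave solution of (E) with speed $c_\ast$, where $\varphi$, re-expressed in the desingularized frame variable $\tau$, is the first component of an orbit homoclinic to $(\phi,\psi)=(0,0)$ of $$\dot\phi=\psi,\qquad\dot\psi=-c_\ast\psi-\phi(1-\phi^2)(\phi^2-a^2).\qquad(\mathrm{D})$$ The equilibrium $(0,0)$ is contained in the isolating block $N=PB$ for (D), where $P=[V_1\ V_2]$ is the eigenmatrix, with columns in the enclosures $$V_1\in\begin{pmatrix}[0.95792122415048908,\,0.95792291154895415]\\ [0.28737526087354431,\,0.28737797983612196]\end{pmatrix},\quad V_2\in\begin{pmatrix}[-0.95792291154868769,\,-0.95792122415055381]\\ [0.28737526087240495,\,0.28737797983793328]\end{pmatrix},$$ and $$B=([-1.0000000013268460,\,1.0001776533279528]\times10^{-5})\times([-1.0177653015013772,\,1.0000001326843545]\times10^{-7}).$$ Finally, $$\xi_{\max}-\xi_{\min}=|\operatorname{supp}u|\in[6.984582800445637,\,7.20846810204],$$ where $|\operatorname{supp}u|$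 is the length of the support of $u(t,\cdot)$.
   Context: Weak solution of $u_t=d(u^{m+1})_{xx}+f(u)$, $d=1/(m+1)$, with initial datum $u_0\in C^0(\mathbb{R})$, $0\le u_0\le1$: a nonnegative $u$ such that for each $r,T>0$, with $Q_T=(0,T)\times\mathbb{R}$, $u\in C(Q_T)\cap L^\infty(Q_T)$ and $$\int_0^T\!\!\int_{-r}^r\{u\phi_t+d\,u^{m+1}\phi_{xx}+f(u)\phi\}dxdt=\int_{-r}^r\{u(T,x)\phi(T,x)-u_0(x)\phi(0,x)\}dx+d\int_0^T\{u^{m+1}(t,r)\phi_x(t,r)-u^{m+1}(t,-r)\phi_x(t,-r)\}dt$$ for all $\phi\in C^{2,1}(\overline{Q_T})$ with $\phi\ge0$, $\phi(t,\pm r)=0$ on $[0,T]$. A traveling wave solution with speed $c$ is a weak solution $u(t,x)=\phi(x-ct)$; it is a compacton traveling wave if its profile $\phi$ has compact support (speed $0$ allowed). The wave variable $\xi=x-ct$ and the desingularized variable $\tau$ are related by $d\tau/d\xi=\phi(\xi)^{-m}$; dots in (D) denote $d/d\tau$. $P$ is a matrix of eigenvectors of the linearization of (D) at $(0,0)$ and $PB=\{Py\mid y\in B\}$. Isolating block: a compact $N$ with $\partial N=N^{\rm exit}\cup N^{\rm ent}$, $N^{\rm exit}$ closed in $\partial N$. A point $x\in\partial N$ is an exit (resp. entrance) point if for every solution $\sigma:[-\delta_1,\delta_2]\to\mathbb{R}^2$ with $\sigma(0)=x$, $\delta_1\ge0$, $\delta_2>0$, there are $0\le\epsilon_1\le\delta_1$,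 $0<\epsilon_2\le\delta_2$ with $\sigma(t)\notin N$ (resp. $\in{\rm int}\,N$) for $0<t\le\epsilon_2$ and $\sigma(t)\notin\partial N$ (resp. $\notin N$) for $-\epsilon_1\le t<0$. *)

theory Defs
  imports "HOL-Analysis.Analysis"
begin

section \<open>Weak solutions of u_t = (u^{m+1})_xx / (m+1) + f(u)\<close>

text \<open>\<open>C21_test T \<zeta> \<zeta>t \<zeta>x \<zeta>xx\<close>: \<open>\<zeta>\<close> is of class $C^{2,1}$ on $[0,T] \times R$ (twice in \<open>x\<close>, once in \<open>t\<close>), with the
  indicated partial derivatives; \<open>\<zeta>t\<close> is one-sided at \<open>t = 0\<close> and \<open>t = T\<close>.\<close>

definition C21_test ::
  "real \<Rightarrow> (real \<Rightarrow> real \<Rightarrow> real) \<Rightarrow> (real \<Rightarrow> real \<Rightarrow> real) \<Rightarrow> (real \<Rightarrow> real \<Rightarrow> real)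
    \<Rightarrow> (real \<Rightarrow> real \<Rightarrow> real) \<Rightarrow> bool"
where
  "C21_test T \<zeta> \<zeta>t \<zeta>x \<zeta>xx \<longleftrightarrow>
     (\<forall>t\<in>{0..T}. \<forall>x.
        ((\<lambda>s. \<zeta> s x) has_real_derivative \<zeta>t t x) (at t within {0..T}) \<and>
        ((\<lambda>y. \<zeta> t y) has_real_derivative \<zeta>x t x) (at x) \<and>
        ((\<lambda>y. \<zeta>x t y) has_real_derivative \<zeta>xx t x) (at x)) \<and>
     (\<forall>g\<in>{\<zeta>, \<zeta>t, \<zeta>x, \<zeta>xx}. continuous_on ({0..T} \<times> UNIV) (\<lambda>(t, x). g t x))"

text \<open>The sign condition on test functions is imposed on \<open>[0,T] \<times> [-r,r]\<close> only: if it were imposed for all real \<open>x\<close>,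
  then \<open>\<zeta>x\<close> would vanish at \<open>x = r\<close> and \<open>x = -r\<close>, and the boundary term would be void.
  A function that is continuous on an open set is essentially bounded there iff it is bounded.\<close>

definition weak_solution ::
  "real \<Rightarrow> (real \<Rightarrow> real) \<Rightarrow> (real \<Rightarrow> real) \<Rightarrow> (real \<Rightarrow> real \<Rightarrow> real) \<Rightarrow> bool"
where
  "weak_solution m f u0 u \<longleftrightarrow>
     continuous_on UNIV u0 \<and> (\<forall>x. 0 \<le> u0 x \<and> u0 x \<le> 1) \<and>
     (\<forall>t>0. \<forall>x. 0 \<le> u t x) \<and>
     (\<forall>r>0. \<forall>T>0.
        continuous_on ({0<..<T} \<times> UNIV) (\<lambda>(t, x). u t x) \<and>
        bounded ((\<lambda>(t, x). u t x) ` ({0<..<T} \<times> UNIV)) \<and>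
        (\<forall>\<zeta> \<zeta>t \<zeta>x \<zeta>xx.
           C21_test T \<zeta> \<zeta>t \<zeta>x \<zeta>xx \<and>
           (\<forall>t\<in>{0..T}. \<forall>x\<in>{-r..r}. 0 \<le> \<zeta> t x) \<and>
           (\<forall>t\<in>{0..T}. \<zeta> t r = 0 \<and> \<zeta> t (-r) = 0) \<longrightarrow>
           integral {0..T} (\<lambda>t. integral {-r..r} (\<lambda>x.
               u t x * \<zeta>t t x + 1 / (m + 1) * u t x powr (m + 1) * \<zeta>xx t x + f (u t x) * \<zeta> t x))
           = integral {-r..r} (\<lambda>x. u T x * \<zeta> T x - u0 x * \<zeta> 0 x)
             + 1 / (m + 1) * integral {0..T} (\<lambda>t.
                 u t r powr (m + 1) * \<zeta>x t r - u t (-r) powr (m + 1) * \<zeta>x t (-r))))"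

text \<open>The initial datum of a traveling wave is its profile.\<close>

definition traveling_wave :: "real \<Rightarrow> (real \<Rightarrow> real) \<Rightarrow> real \<Rightarrow> (real \<Rightarrow> real) \<Rightarrow> bool" where
  "traveling_wave m f c \<phi> \<longleftrightarrow> weak_solution m f \<phi> (\<lambda>t x. \<phi> (x - c * t))"

definition supp :: "(real \<Rightarrow> real) \<Rightarrow> real set" where
  "supp g = closure {x. g x \<noteq> 0}"

definition compacton_traveling_wave ::
  "real \<Rightarrow> (real \<Rightarrow> real) \<Rightarrow> real \<Rightarrow> (real \<Rightarrow> real) \<Rightarrow> bool"
where
  "compacton_traveling_wave m f c \<phi> \<longleftrightarrow> traveling_wave m f c \<phi> \<and> compact (supp \<phi>)"

definition reaction :: "real \<Rightarrow> real \<Rightarrow> real \<Rightarrow> real" where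
  "reaction p a u = u powr p * (1 - u\<^sup>2) * (u\<^sup>2 - a\<^sup>2)"

section \<open>The desingularized system\<close>

definition wave_field :: "real \<Rightarrow> real \<Rightarrow> real^2 \<Rightarrow> real^2" where
  "wave_field c a z =
     vector [z$2, - c * z$2 - z$1 * (1 - (z$1)\<^sup>2) * ((z$1)\<^sup>2 - a\<^sup>2)]"

definition ode_solution_on ::
  "('a::real_normed_vector \<Rightarrow> 'a) \<Rightarrow> real set \<Rightarrow> (real \<Rightarrow> 'a) \<Rightarrow> bool"
where
  "ode_solution_on F I \<sigma> \<longleftrightarrow>
     (\<forall>t\<in>I. (\<sigma> has_vector_derivative F (\<sigma> t)) (at t within I))"

definition homoclinic_orbit ::
  "('a::real_normed_vector \<Rightarrow> 'a) \<Rightarrow> 'a \<Rightarrow> (real \<Rightarrow> 'a) \<Rightarrow> bool"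
where
  "homoclinic_orbit F z \<sigma> \<longleftrightarrow>
     F z = 0 \<and> ode_solution_on F UNIV \<sigma> \<and>
     (\<sigma> \<longlongrightarrow> z) at_bot \<and> (\<sigma> \<longlongrightarrow> z) at_top \<and> (\<exists>t. \<sigma> t \<noteq> z)"

text \<open>\<open>P\<close> is a matrix whose columns are linearly independent eigenvectors of the linearization of \<open>F\<close> at \<open>z\<close>.\<close>

definition eigenmatrix_at :: "(real^'n \<Rightarrow> real^'n) \<Rightarrow> real^'n \<Rightarrow> real^'n^'n \<Rightarrow> bool" where
  "eigenmatrix_at F z P \<longleftrightarrow>
     F differentiable at z \<and> invertible P \<and>
     (\<forall>j. column j P \<noteq> 0 \<and>
          (\<exists>\<mu>::real. frechet_derivative F (at z) (column j P) = \<mu> *\<^sub>R column j P))"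

section \<open>Isolating blocks\<close>

text \<open>A backward time \<open>\<epsilon>1 = 0\<close> is admitted only for solutions with \<open>\<delta>1 = 0\<close>, which have no past;
  otherwise the backward conditions would be void.\<close>

definition exit_point :: "('a::real_normed_vector \<Rightarrow> 'a) \<Rightarrow> 'a set \<Rightarrow> 'a \<Rightarrow> bool" where
  "exit_point F N x \<longleftrightarrow>
     (\<forall>\<delta>1 \<delta>2 \<sigma>. 0 \<le> \<delta>1 \<and> 0 < \<delta>2 \<and> ode_solution_on F {-\<delta>1..\<delta>2} \<sigma> \<and> \<sigma> 0 = x \<longrightarrow>
        (\<exists>\<epsilon>1 \<epsilon>2. 0 \<le> \<epsilon>1 \<and> \<epsilon>1 \<le> \<delta>1 \<and> (0 < \<delta>1 \<longrightarrow> 0 < \<epsilon>1) \<and> 0 < \<epsilon>2 \<and> \<epsilon>2 \<le> \<delta>2 \<and>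
           (\<forall>t. 0 < t \<and> t \<le> \<epsilon>2 \<longrightarrow> \<sigma> t \<notin> N) \<and>
           (\<forall>t. - \<epsilon>1 \<le> t \<and> t < 0 \<longrightarrow> \<sigma> t \<notin> frontier N)))"

definition entrance_point :: "('a::real_normed_vector \<Rightarrow> 'a) \<Rightarrow> 'a set \<Rightarrow> 'a \<Rightarrow> bool" where
  "entrance_point F N x \<longleftrightarrow>
     (\<forall>\<delta>1 \<delta>2 \<sigma>. 0 \<le> \<delta>1 \<and> 0 < \<delta>2 \<and> ode_solution_on F {-\<delta>1..\<delta>2} \<sigma> \<and> \<sigma> 0 = x \<longrightarrow>
        (\<exists>\<epsilon>1 \<epsilon>2. 0 \<le> \<epsilon>1 \<and> \<epsilon>1 \<le> \<delta>1 \<and> (0 < \<delta>1 \<longrightarrow> 0 < \<epsilon>1) \<and> 0 < \<epsilon>2 \<and> \<epsilon>2 \<le> \<delta>2 \<and>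
           (\<forall>t. 0 < t \<and> t \<le> \<epsilon>2 \<longrightarrow> \<sigma> t \<in> interior N) \<and>
           (\<forall>t. - \<epsilon>1 \<le> t \<and> t < 0 \<longrightarrow> \<sigma> t \<notin> N)))"

definition exit_set :: "('a::real_normed_vector \<Rightarrow> 'a) \<Rightarrow> 'a set \<Rightarrow> 'a set" where
  "exit_set F N = {x \<in> frontier N. exit_point F N x}"

definition entrance_set :: "('a::real_normed_vector \<Rightarrow> 'a) \<Rightarrow> 'a set \<Rightarrow> 'a set" where
  "entrance_set F N = {x \<in> frontier N. entrance_point F N x}"

definition isolating_block :: "('a::real_normed_vector \<Rightarrow> 'a) \<Rightarrow> 'a set \<Rightarrow> bool" where
  "isolating_block F N \<longleftrightarrow>
     compact N \<and> frontier N = exit_set F N \<union> entrance_set F N \<and>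
     closedin (top_of_set (frontier N)) (exit_set F N)"

end

theory Submission
  imports Defs "HOL-Real_Asymp.Real_Asymp"
begin

text \<open>The speed is \<open>0\<close>: the system (D) is then Hamiltonian, and its homoclinic orbit is explicit,
  \<open>\<phi>(\<tau>) = (\<alpha> + \<beta> cosh (2 a \<tau>)) powr (-1/2)\<close>. The wave is stationary, and integration by parts shows that it is a
  weak solution, because the flux \<open>(\<phi>^(m+1))' / (m+1)\<close> equals \<open>\<psi>\<close>, which extends continuously by \<open>0\<close>. The width of
  the support is \<open>\<integral> \<phi>^m d\<tau>\<close>, a definite integral that is enclosed by Riemann sums. In eigencoordinates the field
  points outwards on one pair of sides of the parallelogram and inwards on the other; local solutions have to be
  constructed, since an entrance point that no solution meets would vacuously be an exit point.\<close>

section \<open>Local solutions and isolating blocks\<close>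

text \<open>The interval prescribed for the speed contains \<open>0\<close>, where the energy
  \<open>\<psi>^2/2 - a^2 \<phi>^2/2 + (1 + a^2) \<phi>^4/4 - \<phi>^6/6\<close> is conserved; a
  homoclinic orbit of the origin lies on its zero level. There \<open>v = 1/\<phi>^2\<close> obeys a
  first-order equation whose right side is quadratic in \<open>v\<close>, hence the hyperbolic
  cosine. The inequality \<open>3 a^2 < 1\<close> makes \<open>\<alpha> > 1\<close> and
  \<open>\<beta>\<close> real and positive, which keeps the profile between 0 and 1. The exponents
  fit because \<open>m + p = 1\<close>: passing from \<open>\<tau>\<close> to \<open>\<xi>\<close>
  divides by \<open>\<phi>^m\<close> and turns the factor \<open>\<phi>\<close> of the field into
  \<open>\<phi>^p\<close>. What remains is numerical. The width is an integral over the whole line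
  with a fractional power; symmetry halves it, an exponential substitution makes the range
  \<open>[0, 1]\<close>, and eighth powers turn every comparison with the kernel into one between
  rational numbers.\<close>

lemma picard_local_solution:
  fixes F :: "'a::banach \<Rightarrow> 'a"
  assumes lip: "L-lipschitz_on UNIV F" and \<delta>: "0 < \<delta>" "\<delta> * L < 1"
  obtains \<sigma> where "\<sigma> 0 = z" "ode_solution_on F {0..\<delta>} \<sigma>"
proof -
  have L: "0 \<le> L" using lipschitz_on_nonneg[OF lip] .
  have contF: "continuous_on UNIV F" using lipschitz_on_continuous_on[OF lip] .
  \<comment> \<open>Clamping time to \<open>[0, \<delta>]\<close> lets the Picard map act on bounded
    continuous functions on the whole line, a complete metric type to which Banach's fixed point
    theorem applies.\<close>
  define cl where "cl t = max 0 (min \<delta> t)" for t :: real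
  have cl: "cl t \<in> {0..\<delta>}" for t using \<delta> by (auto simp: cl_def)
  have cl_id: "cl t = t" if "t \<in> {0..\<delta>}" for t using that by (auto simp: cl_def)
  have contcl: "continuous_on UNIV cl" unfolding cl_def by (intro continuous_intros)
  have contFf: "continuous_on S (\<lambda>s. F (apply_bcontfun f s))" for f :: "real \<Rightarrow>\<^sub>C 'a" and S
    by (rule continuous_on_compose2[OF contF continuous_on_apply_bcontfun]) auto
  have intF: "(\<lambda>s. F (apply_bcontfun f s)) integrable_on {0..t}" for f :: "real \<Rightarrow>\<^sub>C 'a" and t
    by (rule integrable_continuous_real[OF contFf])
  define J where "J f t = z + integral {0..cl t} (\<lambda>s. F (apply_bcontfun f s))" for f t
  have contJ0: "continuous_on {0..\<delta>} (\<lambda>t. z + integral {0..t} (\<lambda>s. F (apply_bcontfun f s)))" for f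
    by (intro continuous_intros indefinite_integral_continuous_1 intF)
  have contJ: "continuous_on UNIV (J f)" for f
    unfolding J_def by (rule continuous_on_compose2[OF contJ0 contcl]) (use cl in auto)
  have rangeJ: "bounded (range (J f))" for f
  proof -
    have "range (J f) \<subseteq> (\<lambda>t. z + integral {0..t} (\<lambda>s. F (apply_bcontfun f s))) ` {0..\<delta>}"
      using cl by (auto simp: J_def)
    then show ?thesis
      using compact_imp_bounded[OF compact_continuous_image[OF contJ0 compact_Icc]] bounded_subset
      by blast
  qed
  have memJ: "J f \<in> bcontfun" for f
    using contJ rangeJ by (auto simp: bcontfun_def)
  have "\<exists>!f. Bcontfun (J f) = f"
  proof (rule banach_fix_type[where c = "\<delta> * L"])
    show "\<forall>f g. dist (Bcontfun (J f)) (Bcontfun (J g)) \<le> \<delta> * L * dist f g"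
    proof (intro allI dist_bound)
      fix f g t
      have "dist (J f t) (J g t) =
          norm (integral {0..cl t} (\<lambda>s. F (apply_bcontfun f s) - F (apply_bcontfun g s)))"
        by (simp add: J_def dist_norm integral_diff intF)
      also have "\<dots> \<le> L * dist f g * (cl t - 0)"
      proof (rule integral_bound)
        show "continuous_on {0..cl t} (\<lambda>s. F (apply_bcontfun f s) - F (apply_bcontfun g s))"
          by (intro continuous_intros contFf)
        fix s
        have "dist (F (apply_bcontfun f s)) (F (apply_bcontfun g s))
            \<le> L * dist (apply_bcontfun f s) (apply_bcontfun g s)"
          using lipschitz_onD[OF lip] by auto
        also have "\<dots> \<le> L * dist f g"
          using dist_bounded L by (intro mult_left_mono) auto
        finally show "norm (F (apply_bcontfun f s) - F (apply_bcontfun g s)) \<le> L * dist f g"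
          by (simp add: dist_norm)
      qed (use cl[of t] in auto)
      also have "\<dots> \<le> L * dist f g * \<delta>"
        using cl[of t] L by (intro mult_left_mono) auto
      finally show "dist (apply_bcontfun (Bcontfun (J f)) t) (apply_bcontfun (Bcontfun (J g)) t)
          \<le> \<delta> * L * dist f g"
        by (simp add: Bcontfun_inverse memJ mult_ac)
    qed
  qed (use \<delta> L in auto)
  then obtain f where f: "Bcontfun (J f) = f" by blast
  have fix_f: "apply_bcontfun f t = J f t" for t
    using Bcontfun_inverse[OF memJ[of f]] f by simp
  have "ode_solution_on F {0..\<delta>} (apply_bcontfun f)"
    unfolding ode_solution_on_def
  proof
    fix t assume t: "t \<in> {0..\<delta>}"
    have eq: "apply_bcontfun f s = z + integral {0..s} (\<lambda>s. F (apply_bcontfun f s))" if "s \<in> {0..\<delta>}" for s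
      using that by (simp add: fix_f[of s] J_def cl_id)
    have "((\<lambda>t. z + integral {0..t} (\<lambda>s. F (apply_bcontfun f s)))
        has_vector_derivative 0 + F (apply_bcontfun f t)) (at t within {0..\<delta>})"
      by (intro derivative_intros has_vector_derivative_const
          integral_has_vector_derivative[OF contFf t])
    from has_vector_derivative_transform[OF t eq this]
    show "(apply_bcontfun f has_vector_derivative F (apply_bcontfun f t)) (at t within {0..\<delta>})"
      by simp
  qed
  moreover have "apply_bcontfun f 0 = z"
    using \<delta> by (simp add: fix_f[of 0] J_def cl_id)
  ultimately show ?thesis using that by blast
qed

text \<open>One coordinate \<open>f\<close> of a solution is followed near time 0. The factor
  \<open>s\<close> orients time: \<open>s = 1\<close> treats a pair of faces through which the
  solution leaves, \<open>s = -1\<close> a pair through which it enters. On a face the strict sign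
  of the derivative decides the side; strictly between the faces continuity suffices.\<close>

lemma eventually_crossing:
  fixes f :: "real \<Rightarrow> real"
  assumes der: "(f has_real_derivative D) (at 0 within S)"
    and "l \<le> f 0" "f 0 \<le> u" "l < u" and s: "s \<in> {1, -1}"
    and upper: "f 0 = u \<Longrightarrow> 0 < s * D" and lower: "f 0 = l \<Longrightarrow> s * D < 0"
  shows "\<forall>\<^sub>F t in at 0 within S.
    (f 0 \<in> {l, u} \<longrightarrow> (0 < s * t \<longrightarrow> f t \<notin> {l..u}) \<and> (s * t < 0 \<longrightarrow> f t \<in> {l<..<u})) \<and>
    (f 0 \<notin> {l, u} \<longrightarrow> f t \<in> {l<..<u})"
proof -
  have tend: "(f \<longlongrightarrow> f 0) (at 0 within S)"
    using DERIV_continuous[OF der] by (simp add: continuous_within)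
  have below: "\<forall>\<^sub>F t in at 0 within S. f t < u" if "f 0 < u"
    using order_tendstoD(2)[OF tend that] .
  have above: "\<forall>\<^sub>F t in at 0 within S. l < f t" if "l < f 0"
    using order_tendstoD(1)[OF tend that] .
  have monot: "\<forall>\<^sub>F t in at 0 within S. (0 < t \<longrightarrow> f 0 < f t) \<and> (t < 0 \<longrightarrow> f t < f 0)"
    if d: "(f has_real_derivative D) (at 0 within S)" "0 < D" for f :: "real \<Rightarrow> real" and D
  proof -
    obtain d1 where d1: "d1 > 0" "\<And>h. h > 0 \<Longrightarrow> h \<in> S \<Longrightarrow> h < d1 \<Longrightarrow> f 0 < f h"
      using has_real_derivative_pos_inc_right[OF d] by auto
    obtain d2 where d2: "d2 > 0" "\<And>h. h > 0 \<Longrightarrow> - h \<in> S \<Longrightarrow> h < d2 \<Longrightarrow> f (- h) < f 0"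
      using has_real_derivative_pos_inc_left[OF d] by auto
    show ?thesis unfolding eventually_at
      using d1 d2(1) d2(2)[of "- t" for t]
      by (intro exI[of _ "min d1 d2"]) auto
  qed
  have slope: "\<forall>\<^sub>F t in at 0 within S. (0 < s * t \<longrightarrow> f 0 < f t) \<and> (s * t < 0 \<longrightarrow> f t < f 0)"
    if "0 < s * D"
  proof (cases "s = 1")
    case True then show ?thesis using monot[OF der] that by simp
  next
    case False
    then have "\<forall>\<^sub>F t in at 0 within S. (0 < t \<longrightarrow> - f 0 < - f t) \<and> (t < 0 \<longrightarrow> - f t < - f 0)"
      using s that by (intro monot[OF DERIV_minus[OF der]]) auto
    then show ?thesis using False s by (auto elim: eventually_mono)
  qed
  have slope': "\<forall>\<^sub>F t in at 0 within S. (0 < s * t \<longrightarrow> f t < f 0) \<and> (s * t < 0 \<longrightarrow> f 0 < f t)"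
    if "s * D < 0"
  proof (cases "s = 1")
    case True
    then have "\<forall>\<^sub>F t in at 0 within S. (0 < t \<longrightarrow> - f 0 < - f t) \<and> (t < 0 \<longrightarrow> - f t < - f 0)"
      using that by (intro monot[OF DERIV_minus[OF der]]) auto
    then show ?thesis using True by (auto elim: eventually_mono)
  next
    case False
    then have "s = -1" using s by auto
    then show ?thesis using monot[OF der] that by (auto elim: eventually_mono)
  qed
  consider "f 0 = u" | "f 0 = l" | "l < f 0" "f 0 < u" using assms by force
  then show ?thesis
  proof cases
    case 1
    then show ?thesis
      using eventually_conj[OF slope above] upper \<open>l < u\<close> by (auto elim!: eventually_mono)
  next
    case 2
    then show ?thesis
      using eventually_conj[OF slope' below] lower \<open>l < u\<close> by (auto elim!: eventually_mono)
  next
    case 3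
    then show ?thesis
      using eventually_conj[OF above below] by (auto elim!: eventually_mono)
  qed
qed

lemma two_sided_times:
  fixes \<delta>1 \<delta>2 :: real
  assumes "0 \<le> \<delta>1" "0 < \<delta>2"
    and "\<forall>\<^sub>F t in at 0 within {-\<delta>1..\<delta>2}. (0 < t \<longrightarrow> P t) \<and> (t < 0 \<longrightarrow> Q t)"
  shows "\<exists>\<epsilon>1 \<epsilon>2. 0 \<le> \<epsilon>1 \<and> \<epsilon>1 \<le> \<delta>1 \<and> (0 < \<delta>1 \<longrightarrow> 0 < \<epsilon>1) \<and> 0 < \<epsilon>2 \<and> \<epsilon>2 \<le> \<delta>2 \<and>
     (\<forall>t. 0 < t \<and> t \<le> \<epsilon>2 \<longrightarrow> P t) \<and> (\<forall>t. - \<epsilon>1 \<le> t \<and> t < 0 \<longrightarrow> Q t)"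
proof -
  obtain d where d: "d > 0" "\<And>t. t \<in> {-\<delta>1..\<delta>2} \<Longrightarrow> t \<noteq> 0 \<Longrightarrow> \<bar>t\<bar> < d \<Longrightarrow> (0 < t \<longrightarrow> P t) \<and> (t < 0 \<longrightarrow> Q t)"
    using assms(3) unfolding eventually_at by (auto simp: dist_norm)
  show ?thesis
  proof (intro exI conjI allI impI)
    fix t assume "0 < t \<and> t \<le> min \<delta>2 (d/2)"
    then show "P t" using d assms by (auto simp: abs_if dest!: d(2)[rotated -1])
  next
    fix t assume "- min \<delta>1 (d/2) \<le> t \<and> t < 0"
    then show "Q t" using d assms by (auto simp: abs_if dest!: d(2)[rotated -1])
  qed (use d assms in auto)
qed

text \<open>The corners decide the form of the exit set. A solution through a corner leaves across
  its \<open>A\<close>-face, and in backward time it is outside across its \<open>C\<close>-face, so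
  a corner is an exit point. The exit set is therefore the part of the frontier where
  \<open>A\<close> equals \<open>l1\<close> or \<open>u1\<close>, which is closed.\<close>

lemma isolating_block_parallelogram:
  fixes F :: "'a::real_normed_vector \<Rightarrow> 'a" and A C :: "'a \<Rightarrow> real"
  assumes A: "bounded_linear A" and C: "bounded_linear C"
    and N: "N = {z. A z \<in> {l1..u1} \<and> C z \<in> {l2..u2}}" "compact N" and "l1 < u1" "l2 < u2"
    and faces: "\<And>z. z \<in> N \<Longrightarrow> A z = u1 \<Longrightarrow> 0 < A (F z)" "\<And>z. z \<in> N \<Longrightarrow> A z = l1 \<Longrightarrow> A (F z) < 0"
      "\<And>z. z \<in> N \<Longrightarrow> C z = u2 \<Longrightarrow> C (F z) < 0" "\<And>z. z \<in> N \<Longrightarrow> C z = l2 \<Longrightarrow> 0 < C (F z)"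
    and existence: "\<And>z. z \<in> N \<Longrightarrow> \<exists>\<delta>>0. \<exists>\<sigma>. \<sigma> 0 = z \<and> ode_solution_on F {0..\<delta>} \<sigma>"
  shows "isolating_block F N"
proof -
  define U where "U = {z. A z \<in> {l1<..<u1} \<and> C z \<in> {l2<..<u2}}"
  have cont: "continuous_on UNIV A" "continuous_on UNIV C"
    using A C by (auto intro: linear_continuous_on)
  have "U = A -` {l1<..<u1} \<inter> C -` {l2<..<u2}" by (auto simp: U_def)
  then have "open U"
    using cont by (auto intro!: open_Int open_vimage)
  then have UI: "U \<subseteq> interior N" by (intro interior_maximal) (auto simp: U_def N(1))
  have fr: "frontier N \<subseteq> N - U"
    using UI compact_imp_closed[OF N(2)] by (auto simp: frontier_def)
  have der: "((\<lambda>t. A (\<sigma> t)) has_real_derivative A (F z)) (at 0 within {-\<delta>1..\<delta>2})"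
    if "bounded_linear A" "0 \<le> \<delta>1" "0 < \<delta>2" "ode_solution_on F {-\<delta>1..\<delta>2} \<sigma>" "\<sigma> 0 = z"
    for A :: "'a \<Rightarrow> real" and \<delta>1 \<delta>2 \<sigma> z
    using bounded_linear.has_vector_derivative[OF that(1), of \<sigma> "F z" "at 0 within {-\<delta>1..\<delta>2}"] that
    by (auto simp: ode_solution_on_def has_real_derivative_iff_has_vector_derivative)
  have crossA: "\<forall>\<^sub>F t in at 0 within {-\<delta>1..\<delta>2}.
      (A z \<in> {l1, u1} \<longrightarrow> (0 < t \<longrightarrow> A (\<sigma> t) \<notin> {l1..u1}) \<and> (t < 0 \<longrightarrow> A (\<sigma> t) \<in> {l1<..<u1})) \<and>
      (A z \<notin> {l1, u1} \<longrightarrow> A (\<sigma> t) \<in> {l1<..<u1})"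
    if "z \<in> N" "0 \<le> \<delta>1" "0 < \<delta>2" "ode_solution_on F {-\<delta>1..\<delta>2} \<sigma>" "\<sigma> 0 = z" for \<delta>1 \<delta>2 \<sigma> z
    using eventually_crossing[OF der[OF A that(2-5)], of l1 u1 1] that(1,5) faces(1,2)[OF that(1)] \<open>l1 < u1\<close>
    by (auto simp: N)
  have crossC: "\<forall>\<^sub>F t in at 0 within {-\<delta>1..\<delta>2}.
      (C z \<in> {l2, u2} \<longrightarrow> (0 < t \<longrightarrow> C (\<sigma> t) \<in> {l2<..<u2}) \<and> (t < 0 \<longrightarrow> C (\<sigma> t) \<notin> {l2..u2})) \<and>
      (C z \<notin> {l2, u2} \<longrightarrow> C (\<sigma> t) \<in> {l2<..<u2})"
    if "z \<in> N" "0 \<le> \<delta>1" "0 < \<delta>2" "ode_solution_on F {-\<delta>1..\<delta>2} \<sigma>" "\<sigma> 0 = z" for \<delta>1 \<delta>2 \<sigma> z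
    using eventually_crossing[OF der[OF C that(2-5)], of l2 u2 "-1"] that(1,5) faces(3,4)[OF that(1)] \<open>l2 < u2\<close>
    by (auto simp: N conj_commute)
  have exit: "exit_point F N z" if "z \<in> N" "A z \<in> {l1, u1}" for z
    unfolding exit_point_def
  proof (intro allI impI, elim conjE)
    fix \<delta>1 \<delta>2 \<sigma> assume H: "0 \<le> \<delta>1" "0 < (\<delta>2::real)" "ode_solution_on F {-\<delta>1..\<delta>2} \<sigma>" "\<sigma> 0 = z"
    show "\<exists>\<epsilon>1 \<epsilon>2. 0 \<le> \<epsilon>1 \<and> \<epsilon>1 \<le> \<delta>1 \<and> (0 < \<delta>1 \<longrightarrow> 0 < \<epsilon>1) \<and> 0 < \<epsilon>2 \<and> \<epsilon>2 \<le> \<delta>2 \<and>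
           (\<forall>t. 0 < t \<and> t \<le> \<epsilon>2 \<longrightarrow> \<sigma> t \<notin> N) \<and> (\<forall>t. - \<epsilon>1 \<le> t \<and> t < 0 \<longrightarrow> \<sigma> t \<notin> frontier N)"
    proof (rule two_sided_times[OF H(1,2)])
      show "\<forall>\<^sub>F t in at 0 within {-\<delta>1..\<delta>2}. (0 < t \<longrightarrow> \<sigma> t \<notin> N) \<and> (t < 0 \<longrightarrow> \<sigma> t \<notin> frontier N)"
        using crossA[OF that(1) H] crossC[OF that(1) H]
      proof eventually_elim
        case (elim t)
        \<comment> \<open>In backward time \<open>A\<close> is strictly inside its strip. So is
          \<open>C\<close>, unless \<open>z\<close> is a corner, and then \<open>C\<close> has left
          its strip. Either way the frontier is avoided, because it lies in
          \<open>N - U\<close>.\<close>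
        then have "t < 0 \<longrightarrow> \<sigma> t \<in> U \<or> \<sigma> t \<notin> N" using that(2) by (auto simp: U_def N)
        moreover have "0 < t \<longrightarrow> A (\<sigma> t) \<notin> {l1..u1}" using elim(1) that(2) by blast
        then have "0 < t \<longrightarrow> \<sigma> t \<notin> N" by (auto simp: N(1))
        ultimately show ?case using fr by blast
      qed
    qed
  qed
  have entrance: "entrance_point F N z" if "z \<in> N" "A z \<notin> {l1, u1}" "C z \<in> {l2, u2}" for z
    unfolding entrance_point_def
  proof (intro allI impI, elim conjE)
    fix \<delta>1 \<delta>2 \<sigma> assume H: "0 \<le> \<delta>1" "0 < (\<delta>2::real)" "ode_solution_on F {-\<delta>1..\<delta>2} \<sigma>" "\<sigma> 0 = z"
    show "\<exists>\<epsilon>1 \<epsilon>2. 0 \<le> \<epsilon>1 \<and> \<epsilon>1 \<le> \<delta>1 \<and> (0 < \<delta>1 \<longrightarrow> 0 < \<epsilon>1) \<and> 0 < \<epsilon>2 \<and> \<epsilon>2 \<le> \<delta>2 \<and>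
           (\<forall>t. 0 < t \<and> t \<le> \<epsilon>2 \<longrightarrow> \<sigma> t \<in> interior N) \<and> (\<forall>t. - \<epsilon>1 \<le> t \<and> t < 0 \<longrightarrow> \<sigma> t \<notin> N)"
    proof (rule two_sided_times[OF H(1,2)])
      show "\<forall>\<^sub>F t in at 0 within {-\<delta>1..\<delta>2}. (0 < t \<longrightarrow> \<sigma> t \<in> interior N) \<and> (t < 0 \<longrightarrow> \<sigma> t \<notin> N)"
        using crossA[OF that(1) H] crossC[OF that(1) H]
      proof eventually_elim
        case (elim t)
        then have "0 < t \<longrightarrow> \<sigma> t \<in> U" using that by (auto simp: U_def)
        moreover have "t < 0 \<longrightarrow> C (\<sigma> t) \<notin> {l2..u2}" using elim(2) that(3) by blast
        then have "t < 0 \<longrightarrow> \<sigma> t \<notin> N" by (auto simp: N(1))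
        ultimately show ?case using UI by blast
      qed
    qed
  qed
  have not_exit: "\<not> exit_point F N z" if z: "z \<in> N" and ent: "entrance_point F N z" for z
  proof
    assume e: "exit_point F N z"
    obtain \<delta> \<sigma> where s: "0 < \<delta>" "\<sigma> 0 = z" "ode_solution_on F {0..\<delta>} \<sigma>"
      using existence[OF z] by blast
    obtain e1 where e1: "0 < e1" "\<And>t. 0 < t \<and> t \<le> e1 \<Longrightarrow> \<sigma> t \<notin> N"
      using e[unfolded exit_point_def, rule_format, of 0 \<delta> \<sigma>] s by auto
    obtain e2 where e2: "0 < e2" "\<And>t. 0 < t \<and> t \<le> e2 \<Longrightarrow> \<sigma> t \<in> interior N"
      using ent[unfolded entrance_point_def, rule_format, of 0 \<delta> \<sigma>] s by auto
    show False using e1(2)[of "min e1 e2"] e2(2)[of "min e1 e2"] e1(1) e2(1) interior_subset by auto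
  qed
  have frN: "frontier N \<subseteq> N" using fr by auto
  have C_face: "C z \<in> {l2, u2}" if "z \<in> frontier N" "A z \<notin> {l1, u1}" for z
    using that fr by (auto simp: U_def N)
  have exits: "exit_set F N = frontier N \<inter> {z. A z \<in> {l1, u1}}"
    unfolding exit_set_def
    using exit[OF subsetD[OF frN]] not_exit[OF subsetD[OF frN] entrance[OF subsetD[OF frN]]] C_face
    by blast
  have "closed (A -` {l1, u1})"
    using cont by (intro closed_vimage) auto
  then have "closedin (top_of_set (frontier N)) (exit_set F N)"
    unfolding exits by (auto simp: closedin_closed vimage_def)
  moreover have "frontier N = exit_set F N \<union> entrance_set F N"
    unfolding exits using entrance C_face frN by (auto simp: entrance_set_def)
  ultimately show ?thesis using N(2) by (simp add: isolating_block_def)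
qed

text \<open>Composition with the nearest-point projection onto the ball, which is nonexpansive,
  makes the field globally Lipschitz without changing it on the ball. By continuity the solution of
  the modified equation stays in the ball for a short time.\<close>

lemma lipschitz_local_solution:
  fixes F :: "'a::euclidean_space \<Rightarrow> 'a"
  assumes lip: "L-lipschitz_on (cball z r) F" and "0 < r"
  shows "\<exists>\<delta>>0. \<exists>\<sigma>. \<sigma> 0 = z \<and> ode_solution_on F {0..\<delta>} \<sigma>"
proof -
  define \<pi> where "\<pi> = closest_point (cball z r)"
  have ne: "convex (cball z r)" "closed (cball z r)" "cball z r \<noteq> {}" using \<open>0 < r\<close> by auto
  have \<pi>: "\<pi> x \<in> cball z r" for x unfolding \<pi>_def using ne by (intro closest_point_in_set) auto
  have "1-lipschitz_on UNIV \<pi>"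
    using closest_point_lipschitz[OF ne] by (auto simp: \<pi>_def lipschitz_on_def)
  then have "(L * 1)-lipschitz_on UNIV (F \<circ> \<pi>)"
    using lipschitz_on_subset[OF lip] \<pi> by (intro lipschitz_on_compose) blast+
  then have lip': "L-lipschitz_on UNIV (F \<circ> \<pi>)" by simp
  have L: "0 \<le> L" using lipschitz_on_nonneg[OF lip] .
  define \<delta> where "\<delta> = 1 / (L + 1)"
  have \<delta>: "0 < \<delta>" "\<delta> * L < 1" using L by (auto simp: \<delta>_def field_simps)
  obtain \<sigma> where \<sigma>: "\<sigma> 0 = z" "ode_solution_on (F \<circ> \<pi>) {0..\<delta>} \<sigma>"
    using picard_local_solution[OF lip' \<delta>] by blast
  then have "continuous_on {0..\<delta>} \<sigma>"
    by (auto simp: ode_solution_on_def continuous_on_eq_continuous_within intro: has_vector_derivative_continuous)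
  then obtain d where d: "0 < d" "\<And>t. t \<in> {0..\<delta>} \<Longrightarrow> dist t 0 < d \<Longrightarrow> dist (\<sigma> t) (\<sigma> 0) < r"
    using \<delta>(1) \<open>0 < r\<close> unfolding continuous_on_iff by (metis atLeastAtMost_iff less_eq_real_def)
  define e where "e = min \<delta> (d / 2)"
  have e: "0 < e" "{0..e} \<subseteq> {0..\<delta>}" using d \<delta> by (auto simp: e_def)
  have "ode_solution_on F {0..e} \<sigma>"
    unfolding ode_solution_on_def
  proof
    fix t assume t: "t \<in> {0..e}"
    then have "dist (\<sigma> t) (\<sigma> 0) < r" using d e by (intro d) (auto simp: e_def)
    then have "\<pi> (\<sigma> t) = \<sigma> t"
      unfolding \<pi>_def by (intro closest_point_self) (simp add: \<sigma>(1) dist_commute)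
    moreover have "(\<sigma> has_vector_derivative (F \<circ> \<pi>) (\<sigma> t)) (at t within {0..\<delta>})"
      using \<sigma>(2) t e by (auto simp: ode_solution_on_def)
    ultimately show "(\<sigma> has_vector_derivative F (\<sigma> t)) (at t within {0..e})"
      using has_vector_derivative_within_subset[OF _ e(2)] by fastforce
  qed
  then show ?thesis using e(1) \<sigma>(1) by blast
qed

section \<open>The wave field: local existence, eigenvectors, isolating block\<close>

lemma wave_field_local_solution:
  "\<exists>\<delta>>0. \<exists>\<sigma>. \<sigma> 0 = z \<and> ode_solution_on (wave_field c a) {0..\<delta>} \<sigma>"
proof -
  define G where "G x = x * (1 - x\<^sup>2) * (x\<^sup>2 - a\<^sup>2)" for x :: real
  define G' where "G' x = (1 - x\<^sup>2) * (x\<^sup>2 - a\<^sup>2) + x * (- 2 * x) * (x\<^sup>2 - a\<^sup>2) + x * (1 - x\<^sup>2) * (2 * x)" for x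
  have der: "(G has_real_derivative G' x) (at x within X)" for x X
    unfolding G_def[abs_def] G'_def by (rule derivative_eq_intros refl)+ (simp add: algebra_simps)
  define X where "X = {z $ 1 - 1 .. z $ 1 + 1}"
  have "continuous_on X G'" unfolding G'_def[abs_def] by (intro continuous_intros)
  then have "bounded (G' ` X)"
    by (intro compact_imp_bounded compact_continuous_image) (simp_all add: X_def)
  then obtain M where M: "\<And>x. x \<in> X \<Longrightarrow> \<bar>G' x\<bar> \<le> M" by (auto simp: bounded_iff)
  have G_lip: "\<bar>G x - G y\<bar> \<le> M * \<bar>x - y\<bar>" if "x \<in> X" "y \<in> X" for x y
    using field_differentiable_bound[of X G G' M x y] der M that by (simp add: X_def)
  have M0: "0 \<le> M" using M[of "z $ 1"] by (auto simp: X_def)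
  have "(1 + \<bar>c\<bar> + M)-lipschitz_on (cball z 1) (wave_field c a)"
  proof (rule lipschitz_onI)
    fix x y assume "x \<in> cball z 1" "y \<in> cball z 1"
    then have "\<bar>x $ 1 - z $ 1\<bar> \<le> 1" "\<bar>y $ 1 - z $ 1\<bar> \<le> 1"
      using component_le_norm_cart[of "x - z" 1] component_le_norm_cart[of "y - z" 1]
      by (auto simp: dist_norm norm_minus_commute)
    then have X: "x $ 1 \<in> X" "y $ 1 \<in> X" by (auto simp: X_def)
    let ?n = "norm (x - y)"
    have comp: "\<bar>x $ 1 - y $ 1\<bar> \<le> ?n" "\<bar>x $ 2 - y $ 2\<bar> \<le> ?n"
      using component_le_norm_cart[of "x - y"] by auto
    have "norm (wave_field c a x - wave_field c a y) \<le>
        \<bar>x $ 2 - y $ 2\<bar> + \<bar>- c * (x $ 2 - y $ 2) - (G (x $ 1) - G (y $ 1))\<bar>"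
      using norm_le_l1_cart[of "wave_field c a x - wave_field c a y"]
      by (simp add: sum_2 wave_field_def G_def algebra_simps)
    also have "\<dots> \<le> \<bar>x $ 2 - y $ 2\<bar> + (\<bar>c\<bar> * \<bar>x $ 2 - y $ 2\<bar> + M * \<bar>x $ 1 - y $ 1\<bar>)"
      using G_lip[OF X] abs_triangle_ineq4[of "- c * (x $ 2 - y $ 2)" "G (x $ 1) - G (y $ 1)"]
      by (simp add: abs_mult)
    also have "\<dots> \<le> ?n + (\<bar>c\<bar> * ?n + M * ?n)"
      using comp M0 by (intro add_mono mult_left_mono) auto
    finally show "dist (wave_field c a x) (wave_field c a y) \<le> (1 + \<bar>c\<bar> + M) * dist x y"
      by (simp add: dist_norm algebra_simps)
  qed (use M0 in simp)
  then show ?thesis by (rule lipschitz_local_solution) simp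
qed

text \<open>At speed 0 the eigenvalues at the origin are \<open>a\<close> and \<open>-a\<close>,
  with eigenvectors along \<open>(1, a)\<close> and \<open>(-1, a)\<close>. The common scale
  \<open>s\<close> is kept free so that it can be placed in the prescribed enclosures, whose vectors
  do not have exactly unit length.\<close>

definition eigenframe :: "real \<Rightarrow> real \<Rightarrow> real^2^2" where
  "eigenframe a s = vector [vector [s, - s], vector [a * s, a * s]]"

lemma eigenframe_mult: "eigenframe a s *v y = vector [s * (y $ 1 - y $ 2), a * s * (y $ 1 + y $ 2)]"
  by (simp add: eigenframe_def vec_eq_iff forall_2 matrix_vector_mult_def sum_2 algebra_simps)

lemma eigenframe_column:
  "column 1 (eigenframe a s) = vector [s, a * s]" "column 2 (eigenframe a s) = vector [- s, a * s]"
  by (simp_all add: eigenframe_def column_def vec_eq_iff forall_2)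

lemma wave_field_derivative_0:
  "(wave_field c a has_derivative (\<lambda>h. vector [h $ 2, - c * h $ 2 + a\<^sup>2 * h $ 1])) (at 0)"
proof -
  have eq: "(vector [x, y] :: real^2) = x *\<^sub>R axis 1 1 + y *\<^sub>R axis 2 1" for x y :: real
    by (simp add: vec_eq_iff forall_2 axis_def)
  have nth: "((\<lambda>z. z $ i) has_derivative (\<lambda>h. h $ i)) (at 0)" for i :: 2
    by (rule bounded_linear.has_derivative[OF bounded_linear_vec_nth]) (rule has_derivative_ident)
  show ?thesis
    unfolding wave_field_def[abs_def] eq
    by (rule derivative_eq_intros nth refl)+ (simp add: fun_eq_iff algebra_simps power2_eq_square)
qed

lemma eigenmatrix_at_wave_field:
  assumes "0 < a" "0 < s"
  shows "eigenmatrix_at (wave_field 0 a) 0 (eigenframe a s)"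
  unfolding eigenmatrix_at_def
proof (intro conjI allI)
  note D = wave_field_derivative_0[of 0 a]
  show "wave_field 0 a differentiable at 0" using D by (auto simp: differentiable_def)
  have "det (eigenframe a s) = 2 * a * s * s" by (simp add: eigenframe_def det_2)
  then show "invertible (eigenframe a s)" using assms by (simp add: invertible_det_nz)
  fix j :: 2
  show "column j (eigenframe a s) \<noteq> 0"
    using exhaust_2[of j] assms by (auto simp: eigenframe_column vec_eq_iff forall_2)
  have "vector [x $ 2, a\<^sup>2 * x $ 1] = (if j = 1 then a else - a) *\<^sub>R x" if "x = column j (eigenframe a s)" for x
    using exhaust_2[of j] that by (auto simp: eigenframe_column vec_eq_iff forall_2 power2_eq_square)
  then show "\<exists>\<mu>. frechet_derivative (wave_field 0 a) (at 0) (column j (eigenframe a s)) =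
      \<mu> *\<^sub>R column j (eigenframe a s)"
    using frechet_derivative_at[OF D] by (auto simp: fun_eq_iff)
qed

text \<open>In eigencoordinates the field is \<open>(a A, - a C)\<close> plus a remainder of third
  order. \<open>\<eta>\<close> bounds from below, and \<open>\<epsilon>\<close> from above, how far
  the faces are from the origin in these coordinates; \<open>small\<close> says that on the whole
  box the remainder is dominated by \<open>a * \<eta>\<close>, hence by the linear part on each
  face.\<close>

lemma isolating_block_wave_field:
  assumes "0 < a" "0 < s"
    and bounds: "- l1 \<in> {\<eta>..\<epsilon>}" "u1 \<in> {\<eta>..\<epsilon>}" "- l2 \<in> {\<eta>..\<epsilon>}" "u2 \<in> {\<eta>..\<epsilon>}" and "0 < \<eta>"
    and small: "(1 + a\<^sup>2) * (2 * s * \<epsilon>) ^ 3 + (2 * s * \<epsilon>) ^ 5 < 2 * a\<^sup>2 * s * \<eta>"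
  shows "isolating_block (wave_field 0 a)
    ((\<lambda>y. eigenframe a s *v y) ` {y. y $ 1 \<in> {l1..u1} \<and> y $ 2 \<in> {l2..u2}})"
proof -
  \<comment> \<open>\<open>A\<close> and \<open>C\<close> are the components of the inverse of the
    eigenframe.\<close>
  define A where "A z = z $ 1 / (2 * s) + z $ 2 / (2 * a * s)" for z :: "real^2"
  define C where "C z = - z $ 1 / (2 * s) + z $ 2 / (2 * a * s)" for z :: "real^2"
  let ?B = "{y::real^2. y $ 1 \<in> {l1..u1} \<and> y $ 2 \<in> {l2..u2}}"
  let ?N = "(\<lambda>y. eigenframe a s *v y) ` ?B"
  have coords: "z $ 1 = s * (A z - C z)" "z $ 2 = a * s * (A z + C z)" for z
    using assms by (auto simp: A_def C_def field_simps)
  have AP: "A (eigenframe a s *v y) = y $ 1" "C (eigenframe a s *v y) = y $ 2" for y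
    using assms by (auto simp: A_def C_def eigenframe_mult field_simps)
  have N: "?N = {z. A z \<in> {l1..u1} \<and> C z \<in> {l2..u2}}"
  proof (intro equalityI subsetI)
    fix z assume "z \<in> {z. A z \<in> {l1..u1} \<and> C z \<in> {l2..u2}}"
    moreover have "z = eigenframe a s *v vector [A z, C z]"
      using coords[of z] by (simp add: eigenframe_mult vec_eq_iff forall_2)
    ultimately show "z \<in> ?N" by (intro image_eqI[of _ _ "vector [A z, C z]"]) auto
  qed (auto simp: AP)
  have "?B = cbox (vector [l1, l2]) (vector [u1, u2])"
    by (auto simp: set_eq_iff mem_box_cart forall_2)
  then have "compact ?B" by (metis compact_cbox)
  then have "compact ?N"
    by (intro compact_continuous_image linear_continuous_on) (auto simp: linear_conv_bounded_linear[symmetric])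
  have abs_le: "\<bar>z $ 1\<bar> \<le> 2 * s * \<epsilon>" if "z \<in> ?N" for z
  proof -
    have "\<bar>A z - C z\<bar> \<le> 2 * \<epsilon>" using that bounds unfolding N by auto
    then have "s * \<bar>A z - C z\<bar> \<le> s * (2 * \<epsilon>)" using \<open>0 < s\<close> by (intro mult_left_mono) auto
    then show ?thesis using \<open>0 < s\<close> by (simp add: coords abs_mult mult_ac)
  qed
  \<comment> \<open>\<open>n\<close> is the second component of the field without its linear term
    \<open>a^2 x\<close>.\<close>
  define n where "n x = x ^ 5 - (1 + a\<^sup>2) * x ^ 3" for x :: real
  have n: "\<bar>n (z $ 1) / (2 * a * s)\<bar> < a * \<eta>" if "z \<in> ?N" for z
  proof -
    have "\<bar>n (z $ 1)\<bar> \<le> \<bar>z $ 1\<bar> ^ 5 + (1 + a\<^sup>2) * \<bar>z $ 1\<bar> ^ 3"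
      using abs_triangle_ineq4[of "(z $ 1) ^ 5" "(1 + a\<^sup>2) * (z $ 1) ^ 3"] by (simp add: n_def abs_mult power_abs)
    also have "\<dots> \<le> (2 * s * \<epsilon>) ^ 5 + (1 + a\<^sup>2) * (2 * s * \<epsilon>) ^ 3"
      using abs_le[OF that] by (intro add_mono mult_left_mono power_mono) auto
    also have "\<dots> < a * \<eta> * (2 * a * s)" using small by (simp add: power2_eq_square mult_ac)
    finally show ?thesis using assms by (simp add: field_simps abs_mult)
  qed
  have AF: "A (wave_field 0 a z) = a * A z + n (z $ 1) / (2 * a * s)"
    and CF: "C (wave_field 0 a z) = - a * C z + n (z $ 1) / (2 * a * s)" for z
    using assms by (simp_all add: A_def C_def wave_field_def n_def field_simps eval_nat_numeral)
  have prod: "a * \<eta> \<le> a * u1" "a * \<eta> \<le> a * (- l1)" "a * \<eta> \<le> a * u2" "a * \<eta> \<le> a * (- l2)"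
    using bounds \<open>0 < a\<close> by (simp_all only: mult_le_cancel_left_pos atLeastAtMost_iff)
  have faces: "A z = u1 \<Longrightarrow> 0 < A (wave_field 0 a z)" "A z = l1 \<Longrightarrow> A (wave_field 0 a z) < 0"
    "C z = u2 \<Longrightarrow> C (wave_field 0 a z) < 0" "C z = l2 \<Longrightarrow> 0 < C (wave_field 0 a z)" if "z \<in> ?N" for z
    using n[OF that] prod by (simp_all only: AF CF abs_less_iff mult_minus_left mult_minus_right) linarith+
  show ?thesis
  proof (rule isolating_block_parallelogram[OF _ _ N \<open>compact ?N\<close> _ _ faces])
    show "bounded_linear A" "bounded_linear C"
      unfolding A_def[abs_def] C_def[abs_def]
      by (intro bounded_linear_add bounded_linear_compose[OF bounded_linear_divide]
          bounded_linear_minus bounded_linear_vec_nth)+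
    show "l1 < u1" "l2 < u2" using bounds \<open>0 < \<eta>\<close> by auto
  qed (use wave_field_local_solution in auto)
qed

section \<open>Stationary weak solutions\<close>

text \<open>All terms without a time derivative have the single antiderivative
  \<open>W \<zeta>x - \<psi> \<zeta>\<close> in \<open>x\<close>, since the two products
  \<open>\<psi> \<zeta>x\<close> cancel; its \<open>\<zeta>\<close> part vanishes at the ends. The
  remaining term is handled by exchanging the integrals and integrating \<open>\<zeta>t\<close> in
  time. At the finitely many points of \<open>S\<close> continuity of \<open>W\<close> and
  \<open>\<psi>\<close> is enough, which admits the ends of the support.\<close>

lemma stationary_traveling_wave:
  fixes \<phi> \<psi> f :: "real \<Rightarrow> real" and m :: real
  assumes m: "0 < m + 1" and cont_\<phi>: "continuous_on UNIV \<phi>" and range: "\<And>x. 0 \<le> \<phi> x" "\<And>x. \<phi> x \<le> 1"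
    and cont_f: "continuous_on UNIV (\<lambda>x. f (\<phi> x))" and cont_\<psi>: "continuous_on UNIV \<psi>" and "finite S"
    and flux: "\<And>x. x \<notin> S \<Longrightarrow> ((\<lambda>x. 1 / (m + 1) * \<phi> x powr (m + 1)) has_real_derivative \<psi> x) (at x)"
    and balance: "\<And>x. x \<notin> S \<Longrightarrow> (\<psi> has_real_derivative - f (\<phi> x)) (at x)"
  shows "traveling_wave m f 0 \<phi>"
proof -
  define W where "W x = 1 / (m + 1) * \<phi> x powr (m + 1)" for x
  have cont_W: "continuous_on UNIV W"
    unfolding W_def using m range by (intro continuous_intros cont_\<phi> continuous_on_powr') auto
  have identity: "integral {0..T} (\<lambda>t. integral {-r..r} (\<lambda>x.
        \<phi> x * \<zeta>t t x + 1 / (m + 1) * \<phi> x powr (m + 1) * \<zeta>xx t x + f (\<phi> x) * \<zeta> t x))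
      = integral {-r..r} (\<lambda>x. \<phi> x * \<zeta> T x - \<phi> x * \<zeta> 0 x)
        + 1 / (m + 1) * integral {0..T} (\<lambda>t.
            \<phi> r powr (m + 1) * \<zeta>x t r - \<phi> (-r) powr (m + 1) * \<zeta>x t (-r))"
    if "0 < r" "0 < T" and C21: "C21_test T \<zeta> \<zeta>t \<zeta>x \<zeta>xx"
      and bdry: "\<forall>t\<in>{0..T}. \<zeta> t r = 0 \<and> \<zeta> t (-r) = 0"
    for r T and \<zeta> \<zeta>t \<zeta>x \<zeta>xx :: "real \<Rightarrow> real \<Rightarrow> real"
  proof -
    have d: "((\<lambda>s. \<zeta> s x) has_real_derivative \<zeta>t t x) (at t within {0..T})"
        "((\<lambda>y. \<zeta> t y) has_real_derivative \<zeta>x t x) (at x)"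
        "((\<lambda>y. \<zeta>x t y) has_real_derivative \<zeta>xx t x) (at x)" if "t \<in> {0..T}" for t x
      using C21 that by (auto simp: C21_test_def)
    have cont2: "continuous_on ({0..T} \<times> X) (\<lambda>(t, x). g t x)" if "g \<in> {\<zeta>, \<zeta>t, \<zeta>x, \<zeta>xx}" for g X
      using C21 that by (auto simp: C21_test_def intro: continuous_on_subset)
    have cont1: "continuous_on X (\<lambda>x. g t x)" if g: "g \<in> {\<zeta>, \<zeta>t, \<zeta>x, \<zeta>xx}" and t: "t \<in> {0..T}" for g t X
    proof -
      have "continuous_on X (\<lambda>x. case (t, x) of (t, x) \<Rightarrow> g t x)"
        by (rule continuous_on_compose2[OF cont2[OF g, of X]], intro continuous_intros) (use t in auto)
      then show ?thesis by simp
    qed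
    have contt: "continuous_on {0..T} (\<lambda>t. g t x)" if g: "g \<in> {\<zeta>, \<zeta>t, \<zeta>x, \<zeta>xx}" for g x
    proof -
      have "continuous_on {0..T} (\<lambda>t. case (t, x) of (t, x) \<Rightarrow> g t x)"
        by (rule continuous_on_compose2[OF cont2[OF g, of UNIV]], intro continuous_intros) auto
      then show ?thesis by simp
    qed
    define I where "I t = integral {-r..r} (\<lambda>x. \<phi> x * \<zeta>t t x)" for t
    have cont_prod: "continuous_on ({0..T} \<times> {-r..r}) (\<lambda>(t, x). \<phi> x * \<zeta>t t x)"
      using cont2[of \<zeta>t "{-r..r}"] continuous_on_compose2[OF cont_\<phi> continuous_on_snd[OF continuous_on_id]]
      by (auto simp: case_prod_unfold intro!: continuous_intros)
    have inner: "integral {-r..r} (\<lambda>x.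
        \<phi> x * \<zeta>t t x + 1 / (m + 1) * \<phi> x powr (m + 1) * \<zeta>xx t x + f (\<phi> x) * \<zeta> t x)
      = I t + (W r * \<zeta>x t r - W (-r) * \<zeta>x t (-r))" if t: "t \<in> {0..T}" for t
    proof -
      have zero: "\<zeta> t r = 0" "\<zeta> t (- r) = 0" using bdry t by auto
      have "((\<lambda>x. W x * \<zeta>xx t x + f (\<phi> x) * \<zeta> t x) has_integral
          (W r * \<zeta>x t r - \<psi> r * \<zeta> t r) - (W (-r) * \<zeta>x t (-r) - \<psi> (-r) * \<zeta> t (-r))) {-r..r}"
      proof (rule fundamental_theorem_of_calculus_strong[OF \<open>finite S\<close>])
        fix x assume "x \<in> {-r..r} - S"
        then have "x \<notin> S" by simp
        note flux' = flux[OF this, folded W_def] and balance' = balance[OF this]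
        show "((\<lambda>x. W x * \<zeta>x t x - \<psi> x * \<zeta> t x) has_vector_derivative
            W x * \<zeta>xx t x + f (\<phi> x) * \<zeta> t x) (at x)"
          unfolding has_real_derivative_iff_has_vector_derivative[symmetric]
          by (rule derivative_eq_intros flux' balance' d t refl)+ (simp add: algebra_simps)
      next
        show "continuous_on {-r..r} (\<lambda>x. W x * \<zeta>x t x - \<psi> x * \<zeta> t x)"
          by (intro continuous_intros cont1 t continuous_on_subset[OF cont_W] continuous_on_subset[OF cont_\<psi>]) auto
      qed (use \<open>0 < r\<close> in auto)
      note flux_part = this
      have "((\<lambda>x. \<phi> x * \<zeta>t t x) has_integral I t) {-r..r}"
        unfolding I_def
        by (intro integrable_integral integrable_continuous_real continuous_intros
            cont1 t continuous_on_subset[OF cont_\<phi>]) auto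
      from has_integral_add[OF this flux_part]
      have "((\<lambda>x. \<phi> x * \<zeta>t t x + (W x * \<zeta>xx t x + f (\<phi> x) * \<zeta> t x)) has_integral
          I t + (W r * \<zeta>x t r - W (-r) * \<zeta>x t (-r))) {-r..r}"
        by (simp add: zero)
      then show ?thesis
        by (intro integral_unique) (simp add: W_def add.assoc)
    qed
    have int_I: "I integrable_on {0..T}"
    proof (rule integrable_continuous_real)
      show "continuous_on {0..T} I"
        using integral_continuous_on_param[of "{0..T}" "-r" r "\<lambda>t x. \<phi> x * \<zeta>t t x"] cont_prod
        by (simp add: I_def[abs_def])
    qed
    have "integral {0..T} I = integral {-r..r} (\<lambda>x. integral {0..T} (\<lambda>t. \<phi> x * \<zeta>t t x))"
      using integral_swap_continuous[of 0 "-r" T r "\<lambda>t x. \<phi> x * \<zeta>t t x"] cont_prod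
      by (simp add: I_def[abs_def] cbox_Pair_eq)
    also have "\<dots> = integral {-r..r} (\<lambda>x. \<phi> x * \<zeta> T x - \<phi> x * \<zeta> 0 x)"
    proof (rule integral_cong, rule integral_unique, rule fundamental_theorem_of_calculus)
      fix x t assume "t \<in> {0..T}"
      then show "((\<lambda>t. \<phi> x * \<zeta> t x) has_vector_derivative \<phi> x * \<zeta>t t x) (at t within {0..T})"
        unfolding has_real_derivative_iff_has_vector_derivative[symmetric]
        by (intro DERIV_cmult d)
    qed (use \<open>0 < T\<close> in auto)
    finally have time: "integral {0..T} I = integral {-r..r} (\<lambda>x. \<phi> x * \<zeta> T x - \<phi> x * \<zeta> 0 x)" .
    have "integral {0..T} (\<lambda>t. integral {-r..r} (\<lambda>x.
        \<phi> x * \<zeta>t t x + 1 / (m + 1) * \<phi> x powr (m + 1) * \<zeta>xx t x + f (\<phi> x) * \<zeta> t x))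
      = integral {0..T} (\<lambda>t. I t + 1 / (m + 1) * (\<phi> r powr (m + 1) * \<zeta>x t r - \<phi> (-r) powr (m + 1) * \<zeta>x t (-r)))"
      by (rule integral_cong, subst inner) (auto simp: W_def right_diff_distrib diff_divide_distrib)
    also have "\<dots> = integral {0..T} I + integral {0..T} (\<lambda>t. 1 / (m + 1) *
        (\<phi> r powr (m + 1) * \<zeta>x t r - \<phi> (-r) powr (m + 1) * \<zeta>x t (-r)))"
      by (intro integral_add int_I integrable_continuous_real continuous_intros contt) auto
    finally show ?thesis by (simp add: time)
  qed
  have "continuous_on X (\<lambda>(t, x). \<phi> x)" for X :: "(real \<times> real) set"
    using continuous_on_compose2[OF cont_\<phi> continuous_on_snd[OF continuous_on_id]]
    by (simp add: case_prod_unfold)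
  moreover have "bounded ((\<lambda>(t, x). \<phi> x) ` X)" for X :: "(real \<times> real) set"
    using range by (intro boundedI[of _ 1]) auto
  ultimately show ?thesis
    unfolding traveling_wave_def weak_solution_def
    using range cont_\<phi> identity by simp
qed

section \<open>The homoclinic orbit and the wave variable\<close>

locale bistable_wave =
  fixes a :: real
  assumes a_pos: "0 < a" and a_small: "3 * a\<^sup>2 < 1"
begin

text \<open>On the zero energy level, \<open>v = 1 / \<phi>\<^sup>2\<close> satisfies
  \<open>v'\<^sup>2 = 4 (a\<^sup>2 v\<^sup>2 - (1 + a\<^sup>2) v / 2 + 1/3)\<close>, which is solved by \<open>v = \<alpha> + \<beta> cosh (2 a \<tau>)\<close>.\<close>

definition \<alpha> :: real where "\<alpha> = (1 + a\<^sup>2) / (4 * a\<^sup>2)"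
definition \<beta> :: real where "\<beta> = sqrt (\<alpha>\<^sup>2 - 1 / (3 * a\<^sup>2))"
definition v :: "real \<Rightarrow> real" where "v \<tau> = \<alpha> + \<beta> * cosh (2 * a * \<tau>)"
definition g :: "real \<Rightarrow> real" where "g \<tau> = 1 / sqrt (v \<tau>)"
definition h :: "real \<Rightarrow> real" where "h \<tau> = - (a * \<beta> * sinh (2 * a * \<tau>)) / (v \<tau> * sqrt (v \<tau>))"

lemma \<alpha>_gt_1: "1 < \<alpha>"
  using a_pos a_small by (simp add: \<alpha>_def field_simps)

text \<open>Over the denominator \<open>48 a^4\<close> the numerator is
  \<open>3 - 10 a^2 + 3 a^4 = (3 - a^2) (1 - 3 a^2)\<close>, and both factors are positive.\<close>

lemma discriminant_pos: "0 < \<alpha>\<^sup>2 - 1 / (3 * a\<^sup>2)"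
proof -
  have "(3 - a\<^sup>2) * (1 - 3 * a\<^sup>2) > 0" using a_small by (intro mult_pos_pos) auto
  then have "16 * a\<^sup>2 < 3 * (1 + a\<^sup>2)\<^sup>2" by (simp add: power2_eq_square algebra_simps)
  then have "0 < (3 * (1 + a\<^sup>2)\<^sup>2 - 16 * a\<^sup>2) / (48 * a ^ 4)"
    using a_pos by simp
  also have "\<dots> = \<alpha>\<^sup>2 - 1 / (3 * a\<^sup>2)"
    using a_pos by (simp add: \<alpha>_def field_simps power2_eq_square power4_eq_xxxx)
  finally show ?thesis .
qed

lemma \<beta>_pos: "0 < \<beta>" and \<beta>_sq: "\<beta>\<^sup>2 = \<alpha>\<^sup>2 - 1 / (3 * a\<^sup>2)"
  using discriminant_pos by (auto simp: \<beta>_def)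

lemma v_gt_1: "1 < v \<tau>"
  using \<alpha>_gt_1 mult_pos_pos[OF \<beta>_pos cosh_real_pos[of "2 * a * \<tau>"]] by (simp add: v_def)

lemma v_pos: "0 < v \<tau>" using v_gt_1[of \<tau>] by simp

lemma v_deriv: "(v has_real_derivative 2 * a * \<beta> * sinh (2 * a * \<tau>)) (at \<tau>)"
  unfolding v_def[abs_def] by (auto intro!: derivative_eq_intros)

lemma sqrt_v_deriv: "((\<lambda>\<tau>. sqrt (v \<tau>)) has_real_derivative a * \<beta> * sinh (2 * a * \<tau>) / sqrt (v \<tau>)) (at \<tau>)"
  by (rule DERIV_cong[OF DERIV_chain2[OF DERIV_real_sqrt[OF v_pos] v_deriv]]) (simp add: field_simps)

text \<open>This is the zero energy level in the variable \<open>v\<close>: the left side is a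
  quarter of the squared derivative of \<open>v\<close>, and division by \<open>v^3\<close> gives
  \<open>\<psi>^2 = a^2 \<phi>^2 - (1 + a^2)/2 \<phi>^4 + \<phi>^6/3\<close>.\<close>

lemma energy: "(a * \<beta> * sinh (2 * a * \<tau>))\<^sup>2 = a\<^sup>2 * (v \<tau>)\<^sup>2 - (1 + a\<^sup>2) / 2 * v \<tau> + 1 / 3"
proof -
  have "(a * \<beta> * sinh (2 * a * \<tau>))\<^sup>2 = a\<^sup>2 * ((\<beta> * cosh (2 * a * \<tau>))\<^sup>2 - \<beta>\<^sup>2)"
    by (simp add: power_mult_distrib sinh_square_eq algebra_simps)
  also have "\<beta> * cosh (2 * a * \<tau>) = v \<tau> - \<alpha>" by (simp add: v_def)
  also have "a\<^sup>2 * ((v \<tau> - \<alpha>)\<^sup>2 - \<beta>\<^sup>2) = a\<^sup>2 * (v \<tau>)\<^sup>2 - 2 * (a\<^sup>2 * \<alpha>) * v \<tau> + a\<^sup>2 * (1 / (3 * a\<^sup>2))"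
    unfolding \<beta>_sq by (simp add: power2_eq_square algebra_simps)
  also have "a\<^sup>2 * \<alpha> = (1 + a\<^sup>2) / 4" using a_pos by (simp add: \<alpha>_def)
  finally show ?thesis using a_pos by simp
qed

lemma g_pos: "0 < g \<tau>" using v_pos by (simp add: g_def)

lemma g_lt_1: "g \<tau> < 1" using v_gt_1[of \<tau>] by (simp add: g_def)

lemma g_deriv: "(g has_real_derivative h \<tau>) (at \<tau>)"
proof -
  have "((\<lambda>\<tau>. 1 / sqrt (v \<tau>)) has_real_derivative h \<tau>) (at \<tau>)"
    by (rule sqrt_v_deriv v_deriv derivative_eq_intros refl)+
       (use v_pos[of \<tau>] in \<open>auto simp: h_def field_simps\<close>)
  then show ?thesis by (simp add: g_def[abs_def])
qed

text \<open>With \<open>s = sqrt v = 1/g\<close> and \<open>S\<close> for half the derivative of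
  \<open>v\<close>, the quotient rule yields a rational expression in \<open>s\<close> and
  \<open>S^2\<close>. The energy relation eliminates \<open>S^2\<close> and leaves a rational
  identity in \<open>s\<close>.\<close>

lemma h_deriv: "(h has_real_derivative - (g \<tau> * (1 - (g \<tau>)\<^sup>2) * ((g \<tau>)\<^sup>2 - a\<^sup>2))) (at \<tau>)"
proof -
  define s where "s = sqrt (v \<tau>)"
  have s: "0 < s" "v \<tau> = s\<^sup>2" "\<bar>s\<bar> = s" using v_pos[of \<tau>] by (auto simp: s_def)
  define S where "S = a * \<beta> * sinh (2 * a * \<tau>)"
  have C: "a * \<beta> * (cosh (2 * a * \<tau>) * (2 * a)) = 2 * a\<^sup>2 * v \<tau> - (1 + a\<^sup>2) / 2"
    using a_pos by (simp add: v_def \<alpha>_def power2_eq_square field_simps)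
  have E: "S\<^sup>2 = a\<^sup>2 * s ^ 4 - (1 + a\<^sup>2) / 2 * s\<^sup>2 + 1 / 3"
    using energy[of \<tau>] by (simp add: S_def s)
  have D1: "((\<lambda>\<tau>. a * \<beta> * sinh (2 * a * \<tau>)) has_real_derivative 2 * a\<^sup>2 * v \<tau> - (1 + a\<^sup>2) / 2) (at \<tau>)"
    by (rule derivative_eq_intros refl)+ (use C in \<open>simp add: mult_ac\<close>)
  have D2: "((\<lambda>\<tau>. v \<tau> * sqrt (v \<tau>)) has_real_derivative 3 * s * S) (at \<tau>)"
    by (rule sqrt_v_deriv v_deriv derivative_eq_intros refl)+
       (use s in \<open>auto simp: S_def field_simps power2_eq_square\<close>)
  have nz: "v \<tau> * sqrt (v \<tau>) \<noteq> 0" using v_pos[of \<tau>] by simp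
  have "((\<lambda>\<tau>. - (a * \<beta> * sinh (2 * a * \<tau>)) / (v \<tau> * sqrt (v \<tau>))) has_real_derivative
      (- (2 * a\<^sup>2 * v \<tau> - (1 + a\<^sup>2) / 2) * (v \<tau> * sqrt (v \<tau>)) - - S * (3 * s * S))
       / (v \<tau> * sqrt (v \<tau>) * (v \<tau> * sqrt (v \<tau>)))) (at \<tau>)"
    using DERIV_divide[OF DERIV_minus[OF D1] D2 nz] by (simp add: S_def)
  also have "- (2 * a\<^sup>2 * v \<tau> - (1 + a\<^sup>2) / 2) * (v \<tau> * sqrt (v \<tau>)) - - S * (3 * s * S)
      = s * (3 * S\<^sup>2 - (2 * a\<^sup>2 * s\<^sup>2 - (1 + a\<^sup>2) / 2) * s\<^sup>2)"
    by (simp add: s power2_eq_square algebra_simps)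
  also have "\<dots> = s * (a\<^sup>2 * s ^ 4 - (1 + a\<^sup>2) * s\<^sup>2 + 1)"
    unfolding E by (simp add: power2_eq_square power4_eq_xxxx algebra_simps)
  also have "v \<tau> * sqrt (v \<tau>) * (v \<tau> * sqrt (v \<tau>)) = s ^ 6"
    using s by (simp add: power2_eq_square eval_nat_numeral)
  also have "s * (a\<^sup>2 * s ^ 4 - (1 + a\<^sup>2) * s\<^sup>2 + 1) / s ^ 6 = - (1 / s * (1 - (1 / s)\<^sup>2) * ((1 / s)\<^sup>2 - a\<^sup>2))"
    using s(1) by (simp add: divide_simps) (simp add: algebra_simps eval_nat_numeral)
  also have "1 / s = g \<tau>" using s by (simp add: g_def)
  finally show ?thesis by (simp add: h_def[abs_def])
qed

text \<open>A crude consequence of the energy relation, from \<open>a^2 \<le> 1/3\<close> and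
  \<open>v \<ge> 1\<close>. It reduces the decay of \<open>h\<close> at both ends to that of
  \<open>g\<close>.\<close>

lemma abs_h_le: "\<bar>h \<tau>\<bar> \<le> g \<tau>"
proof -
  have "a\<^sup>2 * (v \<tau>)\<^sup>2 \<le> 1 / 3 * (v \<tau>)\<^sup>2" using a_small by (intro mult_right_mono) auto
  moreover have "1 \<le> (v \<tau>)\<^sup>2" using v_gt_1[of \<tau>] by (simp add: one_le_power)
  moreover have "0 \<le> (1 + a\<^sup>2) / 2 * v \<tau>" using v_pos[of \<tau>] by simp
  ultimately have "(a * \<beta> * sinh (2 * a * \<tau>))\<^sup>2 \<le> (v \<tau>)\<^sup>2" using energy[of \<tau>] by linarith
  then have "\<bar>a * \<beta> * sinh (2 * a * \<tau>)\<bar> \<le> v \<tau>" using v_pos[of \<tau>] by (simp add: abs_le_square_iff[symmetric])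
  then have "\<bar>a * \<beta> * sinh (2 * a * \<tau>)\<bar> / (v \<tau> * sqrt (v \<tau>)) \<le> v \<tau> / (v \<tau> * sqrt (v \<tau>))"
    using v_pos[of \<tau>] by (intro divide_right_mono) auto
  then show ?thesis using v_pos[of \<tau>] by (simp add: h_def g_def abs_mult)
qed

lemma g_even: "g (- \<tau>) = g \<tau>" by (simp add: g_def v_def)

lemma g_at_top: "(g \<longlongrightarrow> 0) at_top"
proof -
  have "((\<lambda>\<tau>. 1 / sqrt (\<alpha> + \<beta> * ((exp (2 * a * \<tau>) + exp (- (2 * a * \<tau>))) / 2))) \<longlongrightarrow> 0) at_top"
    using a_pos \<beta>_pos by real_asymp
  then show ?thesis by (simp add: g_def[abs_def] v_def cosh_field_def)
qed

lemma g_at_bot: "(g \<longlongrightarrow> 0) at_bot"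
  using g_at_top by (simp add: filterlim_at_bot_mirror g_even)

lemma h_tendsto: "(h \<longlongrightarrow> 0) at_top" "(h \<longlongrightarrow> 0) at_bot"
  using abs_h_le by (auto intro: Lim_null_comparison[OF _ g_at_top] Lim_null_comparison[OF _ g_at_bot])

lemma homoclinic: "homoclinic_orbit (wave_field 0 a) 0 (\<lambda>\<tau>. vector [g \<tau>, h \<tau>])"
proof -
  have eq: "(vector [x, y] :: real^2) = x *\<^sub>R axis 1 1 + y *\<^sub>R axis 2 1" for x y :: real
    by (simp add: vec_eq_iff forall_2 axis_def)
  have "((\<lambda>\<tau>. vector [g \<tau>, h \<tau>] :: real^2) has_vector_derivative wave_field 0 a (vector [g \<tau>, h \<tau>])) (at \<tau>)" for \<tau>
  proof -
    have "((\<lambda>\<tau>. g \<tau> *\<^sub>R axis 1 1 + h \<tau> *\<^sub>R axis 2 1 :: real^2) has_vector_derivative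
       h \<tau> *\<^sub>R axis 1 1 + (- (g \<tau> * (1 - (g \<tau>)\<^sup>2) * ((g \<tau>)\<^sup>2 - a\<^sup>2))) *\<^sub>R axis 2 1) (at \<tau>)"
      by (rule derivative_eq_intros g_deriv h_deriv refl)+ simp
    moreover have "wave_field 0 a (vector [g \<tau>, h \<tau>]) =
        vector [h \<tau>, - (g \<tau> * (1 - (g \<tau>)\<^sup>2) * ((g \<tau>)\<^sup>2 - a\<^sup>2))]"
      by (simp add: wave_field_def)
    ultimately show ?thesis unfolding eq by simp
  qed
  moreover have "((\<lambda>\<tau>. vector [g \<tau>, h \<tau>] :: real^2) \<longlongrightarrow> 0) F" if "(g \<longlongrightarrow> 0) F" "(h \<longlongrightarrow> 0) F" for F
  proof (rule vec_tendstoI)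
    fix i :: 2
    show "((\<lambda>\<tau>. (vector [g \<tau>, h \<tau>] :: real^2) $ i) \<longlongrightarrow> (0 :: real^2) $ i) F"
      using that exhaust_2[of i] by auto
  qed
  moreover have "wave_field 0 a 0 = 0" by (simp add: wave_field_def vec_eq_iff forall_2)
  moreover have "(vector [g 0, h 0] :: real^2) \<noteq> 0" using g_pos[of 0] by (auto simp: vec_eq_iff forall_2)
  ultimately show ?thesis
    using g_at_top g_at_bot h_tendsto by (auto simp: homoclinic_orbit_def ode_solution_on_def)
qed


section \<open>The wave variable and the half-width of the support\<close>

text \<open>With \<open>y = exp (- a \<tau> / 4)\<close> one has \<open>v = \<beta> / 2 * y powr (-8) * (1 + q y^8 + y^16)\<close>, so that
  \<open>d\<xi>/d\<tau> = \<phi> powr (3/4) = v powr (-3/8)\<close> becomes an integral over a bounded interval in \<open>y\<close>.\<close>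

definition q :: real where "q = 2 * \<alpha> / \<beta>"
definition kernel :: "real \<Rightarrow> real" where "kernel y = (1 + q * y ^ 8 + y ^ 16) powr (- (3/8))"
definition \<Psi> :: "real \<Rightarrow> real" where "\<Psi> y = integral {0..y} (\<lambda>t. 3 * t\<^sup>2 * kernel t)"
text \<open>One has \<open>d\<xi>/d\<tau> = (\<beta>/2) powr (-3/8) * y^3 * kernel y\<close> and
  \<open>dy/d\<tau> = - (a/4) y\<close>. Normalising the weight to \<open>3 y^2\<close>, the
  derivative of \<open>y^3\<close>, leaves this constant. Since \<open>\<tau> = 0\<close>
  corresponds to \<open>y = 1\<close> and the limit of large \<open>\<tau>\<close> to
  \<open>y = 0\<close>, \<open>\<omega>\<close> is half the width.\<close>

definition K :: real where "K = 4 / (3 * a) * (\<beta> / 2) powr (- (3/8))"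
definition \<omega> :: real where "\<omega> = K * \<Psi> 1"
definition \<xi> :: "real \<Rightarrow> real" where "\<xi> \<tau> = K * (\<Psi> 1 - \<Psi> (exp (- (a * \<tau> / 4))))"

lemma q_pos: "0 < q" using \<alpha>_gt_1 \<beta>_pos by (simp add: q_def)

lemma K_pos: "0 < K" using a_pos \<beta>_pos by (simp add: K_def)

lemma kernel_base: "1 \<le> 1 + q * y ^ 8 + y ^ 16"
proof -
  have "0 \<le> q * y ^ 8" "0 \<le> y ^ 16" using q_pos by (simp_all add: zero_le_even_power)
  then show ?thesis by linarith
qed

lemma kernel_bounds: "0 < kernel y" "kernel y \<le> 1"
proof -
  have b: "0 < 1 + q * y ^ 8 + y ^ 16" using kernel_base[of y] by linarith
  then show "0 < kernel y" by (simp add: kernel_def)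
  show "kernel y \<le> 1"
    using powr_mono2'[of "- (3/8)" 1 "1 + q * y ^ 8 + y ^ 16"] kernel_base[of y] by (simp add: kernel_def)
qed

lemma continuous_on_integrand: "continuous_on X (\<lambda>t. 3 * t\<^sup>2 * kernel t)"
proof -
  have "1 + q * y ^ 8 + y ^ 16 \<noteq> 0" for y using kernel_base[of y] by linarith
  then show ?thesis unfolding kernel_def by (intro continuous_intros) auto
qed

lemma \<Psi>_deriv:
  assumes "0 < y"
  shows "(\<Psi> has_real_derivative 3 * y\<^sup>2 * kernel y) (at y)"
proof -
  have "((\<lambda>u. integral {0..u} (\<lambda>t. 3 * t\<^sup>2 * kernel t)) has_real_derivative 3 * y\<^sup>2 * kernel y) (at y within {0..y + 1})"
    by (rule integral_has_real_derivative[OF continuous_on_integrand]) (use assms in auto)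
  moreover have "at y within {0..y + 1} = at y"
    by (rule at_within_interior) (use assms in auto)
  ultimately show ?thesis by (simp add: \<Psi>_def[abs_def])
qed

text \<open>The weight \<open>3 t^2\<close> is integrated exactly, to a difference of cubes, so only
  the kernel has to be bounded. This is one step of the Riemann sums.\<close>

lemma \<Psi>_increment:
  assumes "0 \<le> x" "x \<le> y" and lo: "\<And>t. t \<in> {x..y} \<Longrightarrow> l \<le> kernel t" and up: "\<And>t. t \<in> {x..y} \<Longrightarrow> kernel t \<le> u"
  shows "(y ^ 3 - x ^ 3) * l \<le> \<Psi> y - \<Psi> x" "\<Psi> y - \<Psi> x \<le> (y ^ 3 - x ^ 3) * u"
proof -
  have cube: "((\<lambda>t. 3 * t\<^sup>2 * k) has_integral (y ^ 3 - x ^ 3) * k) {x..y}" for k :: real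
  proof -
    have "((\<lambda>t. 3 * t\<^sup>2 * k) has_integral y ^ 3 * k - x ^ 3 * k) {x..y}"
      by (rule fundamental_theorem_of_calculus[OF \<open>x \<le> y\<close>],
          unfold has_real_derivative_iff_has_vector_derivative[symmetric])
         (auto intro!: derivative_eq_intros)
    then show ?thesis by (simp add: left_diff_distrib)
  qed
  have int: "(\<lambda>t. 3 * t\<^sup>2 * kernel t) integrable_on X" if "X = {c..d}" for X and c d :: real
    unfolding that by (intro integrable_continuous_real continuous_on_integrand)
  have "\<Psi> y = \<Psi> x + integral {x..y} (\<lambda>t. 3 * t\<^sup>2 * kernel t)"
    unfolding \<Psi>_def using Henstock_Kurzweil_Integration.integral_combine[OF assms(1,2) int[OF refl]] by simp
  then have I: "((\<lambda>t. 3 * t\<^sup>2 * kernel t) has_integral \<Psi> y - \<Psi> x) {x..y}"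
    using integrable_integral[OF int[OF refl], of x y] by simp
  show "(y ^ 3 - x ^ 3) * l \<le> \<Psi> y - \<Psi> x"
    by (rule has_integral_le[OF cube I]) (intro mult_left_mono lo, auto)
  show "\<Psi> y - \<Psi> x \<le> (y ^ 3 - x ^ 3) * u"
    by (rule has_integral_le[OF I cube]) (intro mult_left_mono up, auto)
qed

lemma \<Psi>_0: "\<Psi> 0 = 0" by (simp add: \<Psi>_def)

lemma \<Psi>_bounds: "0 \<le> y \<Longrightarrow> 0 \<le> \<Psi> y" "0 \<le> y \<Longrightarrow> \<Psi> y \<le> y ^ 3"
  using \<Psi>_increment[of 0 y 0 1] kernel_bounds \<Psi>_0 by (auto simp: less_imp_le)

lemma g_powr: "g \<tau> powr (3/4) = v \<tau> powr (- (3/8))"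
proof -
  have "g \<tau> = v \<tau> powr (- (1/2))"
    using v_pos[of \<tau>] by (simp add: g_def powr_minus_divide powr_half_sqrt)
  then show ?thesis by (simp add: powr_powr)
qed

lemma \<xi>_deriv: "(\<xi> has_real_derivative g \<tau> powr (3/4)) (at \<tau>)"
proof -
  define y where "y = exp (- (a * \<tau> / 4))"
  have E: "((\<lambda>\<tau>. exp (- (a * \<tau> / 4))) has_real_derivative - (a / 4) * y) (at \<tau>)"
    by (auto intro!: derivative_eq_intros simp: y_def)
  have "((\<lambda>\<tau>. \<Psi> (exp (- (a * \<tau> / 4)))) has_real_derivative 3 * y\<^sup>2 * kernel y * (- (a / 4) * y)) (at \<tau>)"
    unfolding y_def by (rule DERIV_chain2[OF \<Psi>_deriv[OF exp_gt_zero] E[unfolded y_def]])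
  from DERIV_cmult[OF DERIV_diff[OF DERIV_const this], of K "\<Psi> 1"]
  have "(\<xi> has_real_derivative K * (3 * a / 4) * y ^ 3 * kernel y) (at \<tau>)"
    by (simp add: \<xi>_def[abs_def] power2_eq_square power3_eq_cube mult_ac)
  also have "K * (3 * a / 4) * y ^ 3 * kernel y =
      (\<beta> / 2) powr (- (3/8)) * y ^ 3 * (1 + q * y ^ 8 + y ^ 16) powr (- (3/8))"
    using a_pos by (simp add: K_def kernel_def)
  also have "y ^ 3 = exp (2 * a * \<tau>) powr (- (3/8))"
    by (simp add: y_def exp_powr_real flip: exp_of_nat_mult)
  also have "(\<beta> / 2) powr (- (3/8)) * exp (2 * a * \<tau>) powr (- (3/8)) * (1 + q * y ^ 8 + y ^ 16) powr (- (3/8))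
      = (\<beta> / 2 * exp (2 * a * \<tau>) * (1 + q * y ^ 8 + y ^ 16)) powr (- (3/8))"
  proof -
    have "x powr p * z powr p * w powr p = (x * z * w) powr p" if "0 < x" "0 < z" "0 < w" for x z w p :: real
      using that by (simp add: powr_mult)
    then show ?thesis using \<beta>_pos kernel_base[of y] by simp
  qed
  also have "\<beta> / 2 * exp (2 * a * \<tau>) * (1 + q * y ^ 8 + y ^ 16) = v \<tau>"
  proof -
    have y8: "y ^ 8 = exp (- (2 * a * \<tau>))" by (simp add: y_def flip: exp_of_nat_mult)
    have "z * (1 + q * w + w\<^sup>2) = z + q + w" if "z * w = 1" for z w :: real
      using that by algebra
    note cancel = this[of "exp (2 * a * \<tau>)" "y ^ 8"]
    have "exp (2 * a * \<tau>) * y ^ 8 = 1" unfolding y8 by (simp flip: exp_add)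
    from cancel[OF this]
    have "exp (2 * a * \<tau>) * (1 + q * y ^ 8 + y ^ 16) = exp (2 * a * \<tau>) + q + y ^ 8"
      by (simp flip: power_mult)
    then have "\<beta> / 2 * exp (2 * a * \<tau>) * (1 + q * y ^ 8 + y ^ 16) = \<beta> / 2 * (exp (2 * a * \<tau>) + q + y ^ 8)"
      by (simp only: mult.assoc)
    also have "\<dots> = v \<tau>"
      using \<beta>_pos unfolding y8 by (simp add: v_def q_def cosh_field_def field_simps)
    finally show ?thesis .
  qed
  finally show ?thesis by (simp add: g_powr)
qed

text \<open>The derivative of \<open>\<xi>\<close> is even and \<open>\<xi> 0 = 0\<close>. The
  behaviour at the left end then follows from that at the right end, with no study of
  \<open>\<Psi>\<close> at large arguments, which negative \<open>\<tau>\<close> would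
  require.\<close>

lemma \<xi>_odd: "\<xi> (- \<tau>) = - \<xi> \<tau>"
proof -
  have "((\<lambda>\<tau>. \<xi> (- \<tau>) + \<xi> \<tau>) has_real_derivative 0) (at \<tau>)" for \<tau>
    using DERIV_add[OF DERIV_chain2[OF \<xi>_deriv DERIV_minus[OF DERIV_ident]] \<xi>_deriv] by (simp add: g_even)
  then have "\<xi> (- \<tau>) + \<xi> \<tau> = \<xi> (- 0) + \<xi> 0" by (intro DERIV_isconst_all[of "\<lambda>\<tau>. \<xi> (- \<tau>) + \<xi> \<tau>"]) auto
  then show ?thesis by (simp add: \<xi>_def)
qed

lemma \<xi>_at_top: "(\<xi> \<longlongrightarrow> \<omega>) at_top"
proof -
  have "((\<lambda>\<tau>. exp (- (a * \<tau> / 4)) ^ 3) \<longlongrightarrow> 0) at_top" using a_pos by real_asymp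
  then have "((\<lambda>\<tau>. \<Psi> (exp (- (a * \<tau> / 4)))) \<longlongrightarrow> 0) at_top"
    by (rule Lim_null_comparison[rotated]) (use \<Psi>_bounds in auto)
  from tendsto_mult_left[OF tendsto_diff[OF tendsto_const this], of K "\<Psi> 1"]
  show ?thesis by (simp add: \<xi>_def[abs_def] \<omega>_def)
qed

lemma \<xi>_strict_mono:
  assumes "s < t"
  shows "\<xi> s < \<xi> t"
proof (rule DERIV_pos_imp_increasing[OF assms])
  show "\<exists>d. DERIV \<xi> x :> d \<and> 0 < d" for x
    using \<xi>_deriv[of x] g_pos[of x] by (intro exI[of _ "g x powr (3/4)"]) auto
qed

lemma \<xi>_less: "\<xi> \<tau> < \<omega>"
proof -
  have "\<forall>\<^sub>F t in at_top. \<xi> (\<tau> + 1) \<le> \<xi> t"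
    using eventually_gt_at_top[of "\<tau> + 1"] by eventually_elim (simp add: \<xi>_strict_mono less_imp_le)
  then have "\<xi> (\<tau> + 1) \<le> \<omega>" by (rule tendsto_lowerbound[OF \<xi>_at_top]) simp
  then show ?thesis using \<xi>_strict_mono[of \<tau> "\<tau> + 1"] by simp
qed

lemma \<xi>_bij: "bij_betw \<xi> UNIV {-\<omega><..<\<omega>}"
proof -
  have "inj \<xi>" using \<xi>_strict_mono by (metis injI less_irrefl linorder_neqE_linordered_idom)
  moreover have "\<exists>\<tau>. x = \<xi> \<tau>" if x: "- \<omega> < x" "x < \<omega>" for x
  proof -
    have big: "\<exists>t>0. z < \<xi> t" if "z < \<omega>" for z
      using eventually_conj[OF order_tendstoD(1)[OF \<xi>_at_top that] eventually_gt_at_top[of 0]]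
      by (auto simp: eventually_at_top_linorder)
    obtain t1 t2 where t: "0 < t1" "x < \<xi> t1" "0 < t2" "- x < \<xi> t2" using big[of x] big[of "- x"] x by auto
    have "\<exists>\<tau>\<ge>-t2. \<tau> \<le> t1 \<and> \<xi> \<tau> = x"
      by (rule IVT) (use t \<xi>_odd DERIV_isCont[OF \<xi>_deriv] in auto)
    then show ?thesis by auto
  qed
  moreover have "- \<omega> < \<xi> \<tau>" for \<tau> using \<xi>_less[of "- \<tau>"] by (simp add: \<xi>_odd)
  ultimately show ?thesis using \<xi>_less by (auto simp: bij_betw_def image_iff)
qed

lemma \<omega>_pos: "0 < \<omega>" using \<xi>_less[of 0] by (simp add: \<xi>_def)

section \<open>Transport of the orbit to the wave variable\<close>

definition T :: "real \<Rightarrow> real" where "T = inv \<xi>"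

lemma T_bij: "bij_betw T {-\<omega><..<\<omega>} UNIV"
  unfolding T_def by (rule bij_betw_inv_into[OF \<xi>_bij])

lemma T_\<xi>: "T (\<xi> \<tau>) = \<tau>"
  using \<xi>_bij by (simp add: T_def bij_betw_def)

lemma \<xi>_T: "x \<in> {-\<omega><..<\<omega>} \<Longrightarrow> \<xi> (T x) = x"
  unfolding T_def by (rule bij_betw_inv_into_right[OF \<xi>_bij])

lemma T_deriv:
  assumes x: "x \<in> {-\<omega><..<\<omega>}"
  shows "(T has_real_derivative g (T x) powr (- (3/4))) (at x)"
proof -
  have "isCont T (\<xi> (T x))"
    by (rule isCont_inverse_function2[of "T x - 1" _ "T x + 1"])
       (use T_\<xi> DERIV_isCont[OF \<xi>_deriv] in auto)
  then have "isCont T x" using x by (simp add: \<xi>_T)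
  then have "DERIV T x :> inverse (g (T x) powr (3/4))"
    using x g_pos[of "T x"] \<xi>_T by (intro DERIV_inverse_function[OF \<xi>_deriv, of _ _ "-\<omega>" \<omega>]) auto
  then show ?thesis by (simp add: powr_minus)
qed

definition in_frame :: "(real \<Rightarrow> real) \<Rightarrow> real \<Rightarrow> real" where
  "in_frame f x = (if x \<in> {-\<omega><..<\<omega>} then f (T x) else 0)"

text \<open>The critical points are the ends of the support. Times at which \<open>f\<close> is not
  yet small lie in some \<open>[t2, t1]\<close>, whose image under \<open>\<xi>\<close> is closed
  and contained in the open interval; a point outside that interval thus has a neighbourhood on
  which the transported function is small.\<close>

lemma continuous_in_frame:
  assumes cont: "continuous_on UNIV f" and lim: "(f \<longlongrightarrow> 0) at_top" "(f \<longlongrightarrow> 0) at_bot"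
  shows "continuous_on UNIV (in_frame f)"
proof -
  have "isCont (in_frame f) x" if x: "x \<in> {-\<omega><..<\<omega>}" for x
  proof -
    have "isCont (\<lambda>x. f (T x)) x"
      by (rule isCont_o2[OF DERIV_isCont[OF T_deriv[OF x]]])
         (use cont in \<open>simp add: continuous_on_eq_continuous_at\<close>)
    moreover have near: "\<forall>\<^sub>F y in nhds x. in_frame f y = f (T y)"
      using eventually_nhds_in_open[OF open_greaterThanLessThan x] by eventually_elim (simp add: in_frame_def)
    ultimately show ?thesis by (simp add: isCont_cong[OF near])
  qed
  moreover have "isCont (in_frame f) x" if x: "x \<notin> {-\<omega><..<\<omega>}" for x
  proof -
    have "\<forall>\<^sub>F y in nhds x. dist (in_frame f y) 0 < e" if "0 < e" for e
    proof -
      obtain t1 t2 where t: "\<And>t. t1 \<le> t \<Longrightarrow> dist (f t) 0 < e" "\<And>t. t \<le> t2 \<Longrightarrow> dist (f t) 0 < e"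
        using tendstoD[OF lim(1) \<open>0 < e\<close>] tendstoD[OF lim(2) \<open>0 < e\<close>]
        by (auto simp: eventually_at_top_linorder eventually_at_bot_linorder)
      have "\<xi> t1 \<in> {-\<omega><..<\<omega>}" "\<xi> t2 \<in> {-\<omega><..<\<omega>}" using \<xi>_bij by (auto simp: bij_betw_def)
      then have "x \<in> - {\<xi> t2..\<xi> t1}" using x by auto
      then have "\<forall>\<^sub>F y in nhds x. y \<in> - {\<xi> t2..\<xi> t1}"
        by (intro eventually_nhds_in_open) (auto intro: open_Compl)
      moreover have "dist (in_frame f y) 0 < e" if "y \<in> - {\<xi> t2..\<xi> t1}" for y
      proof (cases "y \<in> {-\<omega><..<\<omega>}")
        case True
        then have "T y \<le> t2 \<or> t1 \<le> T y"
          using that \<xi>_strict_mono[of t2 "T y"] \<xi>_strict_mono[of "T y" t1] by (force simp: \<xi>_T)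
        then show ?thesis using t True by (auto simp: in_frame_def)
      qed (use \<open>0 < e\<close> in \<open>auto simp: in_frame_def\<close>)
      ultimately show ?thesis
        by (rule eventually_mono)
    qed
    then have "(in_frame f \<longlongrightarrow> 0) (nhds x)" by (rule tendstoI)
    moreover have "in_frame f x = 0" using x by (auto simp: in_frame_def)
    ultimately show ?thesis unfolding isCont_def by (metis tendsto_mono at_within_le_nhds)
  qed
  ultimately show ?thesis by (auto simp: continuous_on_eq_continuous_at)
qed

lemma in_frame_deriv:
  assumes f: "\<And>\<tau>. (f has_real_derivative f' \<tau>) (at \<tau>)" and x: "x \<notin> {-\<omega>, \<omega>}"
  shows "(in_frame f has_real_derivative in_frame (\<lambda>\<tau>. f' \<tau> * g \<tau> powr (- (3/4))) x) (at x)"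
proof (cases "x \<in> {-\<omega><..<\<omega>}")
  case True
  have "((\<lambda>x. f (T x)) has_real_derivative f' (T x) * g (T x) powr (- (3/4))) (at x)"
    by (rule DERIV_chain2[OF f T_deriv[OF True]])
  then have "(in_frame f has_real_derivative f' (T x) * g (T x) powr (- (3/4))) (at x)"
    by (rule has_field_derivative_transform_within_open[OF _ open_greaterThanLessThan True]) (simp add: in_frame_def)
  then show ?thesis using True by (simp add: in_frame_def)
next
  case False
  then have "x \<in> - {-\<omega>..\<omega>}" using x by auto
  have "(in_frame f has_real_derivative 0) (at x)"
    by (rule has_field_derivative_transform_within_open[OF DERIV_const, of "- {-\<omega>..\<omega>}" x 0])
       (use \<open>x \<in> - {-\<omega>..\<omega>}\<close> in \<open>auto simp: in_frame_def\<close>)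
  then show ?thesis using False by (auto simp: in_frame_def)
qed

lemma supp_in_frame_g: "supp (in_frame g) = {-\<omega>..\<omega>}"
proof -
  have "{x. in_frame g x \<noteq> 0} = {-\<omega><..<\<omega>}" using g_pos by (auto simp: in_frame_def less_imp_neq[symmetric])
  then show ?thesis using \<omega>_pos by (simp add: supp_def)
qed

lemma compacton: "compacton_traveling_wave (3/4) (reaction (1/4) a) 0 (in_frame g)"
proof -
  have cont: "continuous_on UNIV g" "continuous_on UNIV h"
    using DERIV_isCont[OF g_deriv] DERIV_isCont[OF h_deriv] by (auto simp: continuous_on_eq_continuous_at)
  have cont_g: "continuous_on UNIV (in_frame g)"
    using continuous_in_frame cont g_at_top g_at_bot by blast
  have range: "0 \<le> in_frame g x" "in_frame g x \<le> 1" for x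
    using g_pos[of "T x"] g_lt_1[of "T x"] by (auto simp: in_frame_def)
  have "traveling_wave (3/4) (reaction (1/4) a) 0 (in_frame g)"
  \<comment> \<open>The exceptional set consists of the ends of the support, where
    \<open>in_frame\<close> switches from the orbit to \<open>0\<close>.\<close>
  proof (rule stationary_traveling_wave[where \<psi> = "in_frame h" and S = "{-\<omega>, \<omega>}"])
    show "continuous_on UNIV (\<lambda>x. reaction (1/4) a (in_frame g x))"
      unfolding reaction_def
      by (intro continuous_intros cont_g continuous_on_powr') (use range in auto)
    show "continuous_on UNIV (in_frame h)"
      using continuous_in_frame cont h_tendsto by blast
    fix x assume x: "x \<notin> {-\<omega>, \<omega>}"
    have "((\<lambda>\<tau>. 1 / (3/4 + 1) * g \<tau> powr (3/4 + 1)) has_real_derivative h \<tau> * g \<tau> powr (3/4)) (at \<tau>)" for \<tau>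
      using DERIV_cmult[OF DERIV_fun_powr[OF g_deriv g_pos, of "3/4 + 1"], of "1 / (3/4 + 1)"] by simp
    note D = in_frame_deriv[OF this x]
    \<comment> \<open>Outside the support this rests on \<open>0 powr (3/4 + 1) = 0\<close>.\<close>
    have F: "in_frame (\<lambda>\<tau>. 1 / (3/4 + 1) * g \<tau> powr (3/4 + 1)) = (\<lambda>x. 1 / (3/4 + 1) * in_frame g x powr (3/4 + 1))"
      by (simp add: in_frame_def fun_eq_iff)
    have d: "in_frame (\<lambda>\<tau>. h \<tau> * g \<tau> powr (3/4) * g \<tau> powr (- (3/4))) x = in_frame h x"
      using g_pos by (simp add: in_frame_def powr_minus less_imp_neq[symmetric])
    show "((\<lambda>x. 1 / (3/4 + 1) * in_frame g x powr (3/4 + 1)) has_real_derivative in_frame h x) (at x)"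
      using D unfolding F d .
    \<comment> \<open>Here \<open>m + p = 1\<close> enters:
      \<open>g * g powr (- (3/4)) = g powr (1/4)\<close>.\<close>
    have "- (g \<tau> * (1 - (g \<tau>)\<^sup>2) * ((g \<tau>)\<^sup>2 - a\<^sup>2)) * g \<tau> powr (- (3/4)) = - reaction (1/4) a (g \<tau>)" for \<tau>
    proof -
      have "g \<tau> * g \<tau> powr (- (3/4)) = g \<tau> powr (1/4)"
        using powr_add[of "g \<tau>" 1 "- (3/4)"] g_pos[of \<tau>] by simp
      then show ?thesis by (simp add: reaction_def mult_ac)
    qed
    then have "in_frame (\<lambda>\<tau>. - (g \<tau> * (1 - (g \<tau>)\<^sup>2) * ((g \<tau>)\<^sup>2 - a\<^sup>2)) * g \<tau> powr (- (3/4))) x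
        = - reaction (1/4) a (in_frame g x)"
      by (simp add: in_frame_def reaction_def)
    then show "(in_frame h has_real_derivative - reaction (1/4) a (in_frame g x)) (at x)"
      using in_frame_deriv[OF h_deriv x] by simp
  qed (use cont_g range in auto)
  then show ?thesis by (simp add: compacton_traveling_wave_def supp_in_frame_g)
qed

end

section \<open>Enclosure of the width\<close>

lemma powr_neg_three_eighths:
  fixes x :: real
  assumes "0 < x"
  shows "(x powr (- (3/8))) ^ 8 * x ^ 3 = 1"
proof -
  have "(x powr (- (3/8))) ^ 8 = x powr (- 3)" using assms by (simp add: powr_power)
  then show ?thesis using assms by (simp add: powr_minus)
qed

text \<open>Raising to the eighth power removes the fractional exponent: a rational bound
  \<open>k\<close> is certified by comparing \<open>k^8 X^3\<close> with 1, where the rational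
  \<open>X\<close> bounds the possibly irrational \<open>x\<close> from the appropriate
  side.\<close>

lemma powr_neg_three_eighths_bounds:
  fixes x X k :: real
  assumes "0 < x" "0 \<le> k"
  shows "x \<le> X \<Longrightarrow> k ^ 8 * X ^ 3 \<le> 1 \<Longrightarrow> k \<le> x powr (- (3/8))"
    and "0 < X \<Longrightarrow> X \<le> x \<Longrightarrow> 1 \<le> k ^ 8 * X ^ 3 \<Longrightarrow> x powr (- (3/8)) \<le> k"
proof -
  let ?w = "x powr (- (3/8))"
  note eq = powr_neg_three_eighths[OF \<open>0 < x\<close>]
  show "k \<le> ?w" if "x \<le> X" "k ^ 8 * X ^ 3 \<le> 1"
  proof -
    have "k ^ 8 * x ^ 3 \<le> k ^ 8 * X ^ 3" using that assms by (intro mult_left_mono power_mono) auto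
    also have "\<dots> \<le> ?w ^ 8 * x ^ 3" using that eq by simp
    finally have "k ^ 8 \<le> ?w ^ 8" using assms by simp
    then show ?thesis using assms by (simp add: power_mono_iff)
  qed
  show "?w \<le> k" if "0 < X" "X \<le> x" "1 \<le> k ^ 8 * X ^ 3"
  proof -
    have "?w ^ 8 * x ^ 3 \<le> k ^ 8 * X ^ 3" using that eq by simp
    also have "\<dots> \<le> k ^ 8 * x ^ 3" using that assms by (intro mult_left_mono power_mono) auto
    finally have "?w ^ 8 \<le> k ^ 8" using assms by simp
    then show ?thesis using assms by (simp add: power_mono_iff)
  qed
qed

text \<open>A list of triples \<open>(y, b, k)\<close> is a partition of \<open>[x, 1]\<close> into intervals with right end points \<open>y\<close>, each with a
  bound \<open>k\<close> for the kernel on it. The kernel is decreasing, so a lower bound is certified at the right end point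
  and an upper bound at the left one; \<open>Q\<close> is a rational bound for \<open>q\<close>, and \<open>b\<close> is a rounded value of the base of
  the power in the kernel, which keeps the numbers in the certificate short.\<close>

primrec cubic_sum :: "real \<Rightarrow> (real \<times> real \<times> real) list \<Rightarrow> real" where
  "cubic_sum x [] = 0"
| "cubic_sum x (p # ps) = (fst p ^ 3 - x ^ 3) * snd (snd p) + cubic_sum (fst p) ps"

primrec certified_lower :: "real \<Rightarrow> real \<Rightarrow> (real \<times> real \<times> real) list \<Rightarrow> bool" where
  "certified_lower Q x [] \<longleftrightarrow> x = 1"
| "certified_lower Q x (p # ps) \<longleftrightarrow> x \<le> fst p \<and> 0 \<le> snd (snd p) \<and>
     1 + Q * fst p ^ 8 + fst p ^ 16 \<le> fst (snd p) \<and> snd (snd p) ^ 8 * fst (snd p) ^ 3 \<le> 1 \<and>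
     certified_lower Q (fst p) ps"

primrec certified_upper :: "real \<Rightarrow> real \<Rightarrow> (real \<times> real \<times> real) list \<Rightarrow> bool" where
  "certified_upper Q x [] \<longleftrightarrow> x = 1"
| "certified_upper Q x (p # ps) \<longleftrightarrow> x \<le> fst p \<and> 0 \<le> snd (snd p) \<and> 0 < fst (snd p) \<and>
     fst (snd p) \<le> 1 + Q * x ^ 8 + x ^ 16 \<and> 1 \<le> snd (snd p) ^ 8 * fst (snd p) ^ 3 \<and>
     certified_upper Q (fst p) ps"

context bistable_wave
begin

lemma kernel_base_pos: "0 \<le> Q \<Longrightarrow> 0 < 1 + Q * y ^ 8 + y ^ 16" for Q y :: real
  using zero_le_even_power[of 8 y] zero_le_even_power[of 16 y] by (simp add: add_pos_nonneg)

lemma cubic_sum_le_\<Psi>: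
  assumes "certified_lower Q x ps" "q \<le> Q" "0 \<le> x"
  shows "cubic_sum x ps \<le> \<Psi> 1 - \<Psi> x"
  using assms(1,3)
proof (induction ps arbitrary: x)
  case (Cons p ps)
  obtain y b k where p: "p = (y, b, k)" by (cases p)
  have c: "x \<le> y" "0 \<le> k" "1 + Q * y ^ 8 + y ^ 16 \<le> b" "k ^ 8 * b ^ 3 \<le> 1"
    using Cons.prems by (auto simp: p)
  have "k \<le> kernel t" if t: "t \<in> {x..y}" for t
    unfolding kernel_def
  proof (rule powr_neg_three_eighths_bounds(1)[OF _ \<open>0 \<le> k\<close> _ c(4)])
    have "1 + q * t ^ 8 + t ^ 16 \<le> 1 + Q * y ^ 8 + y ^ 16"
      using t \<open>q \<le> Q\<close> q_pos Cons.prems by (intro add_mono mult_mono power_mono) auto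
    then show "1 + q * t ^ 8 + t ^ 16 \<le> b" using c(3) by simp
  qed (use kernel_base_pos q_pos in auto)
  then have "(y ^ 3 - x ^ 3) * k \<le> \<Psi> y - \<Psi> x"
    using \<Psi>_increment(1)[of x y k 1] c Cons.prems kernel_bounds by auto
  then show ?case using Cons.IH[of y] Cons.prems c by (auto simp: p)
qed simp

lemma \<Psi>_le_cubic_sum:
  assumes "certified_upper Q x ps" "0 \<le> Q" "Q \<le> q" "0 \<le> x"
  shows "\<Psi> 1 - \<Psi> x \<le> cubic_sum x ps"
  using assms(1,4)
proof (induction ps arbitrary: x)
  case (Cons p ps)
  obtain y b k where p: "p = (y, b, k)" by (cases p)
  have c: "x \<le> y" "0 \<le> k" "0 < b" "b \<le> 1 + Q * x ^ 8 + x ^ 16" "1 \<le> k ^ 8 * b ^ 3"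
    using Cons.prems by (auto simp: p)
  have "kernel t \<le> k" if t: "t \<in> {x..y}" for t
    unfolding kernel_def
  proof (rule powr_neg_three_eighths_bounds(2)[OF _ \<open>0 \<le> k\<close> \<open>0 < b\<close> _ c(5)])
    have "1 + Q * x ^ 8 + x ^ 16 \<le> 1 + q * t ^ 8 + t ^ 16"
      using t \<open>Q \<le> q\<close> q_pos Cons.prems by (intro add_mono mult_mono power_mono) auto
    then show "b \<le> 1 + q * t ^ 8 + t ^ 16" using c(4) by simp
  qed (use kernel_base_pos q_pos \<open>0 \<le> Q\<close> in auto)
  then have "\<Psi> y - \<Psi> x \<le> (y ^ 3 - x ^ 3) * k"
    using \<Psi>_increment(2)[of x y 0 k] c Cons.prems kernel_bounds by (auto simp: less_imp_le)
  then show ?case using Cons.IH[of y] Cons.prems c by (auto simp: p)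
qed simp

end

lemma bistable_wave_three_tenths: "bistable_wave (3/10)"
  by unfold_locales (simp_all add: power2_eq_square)

lemma width_bounds: "2 * bistable_wave.\<omega> (3/10) \<in> {6.984582800445637 .. 7.20846810204}"
proof -
  interpret bistable_wave "3/10" by (rule bistable_wave_three_tenths)
  have \<alpha>: "\<alpha> = 109 / 36" by (simp add: \<alpha>_def power2_eq_square)
  have \<beta>2: "\<beta>\<^sup>2 = (109 / 36)\<^sup>2 - 100 / 27" using \<beta>_sq by (simp add: \<alpha> power2_eq_square)
  have \<beta>: "2.3374 \<le> \<beta>" "\<beta> \<le> 2.3375"
  proof -
    have "2.3374\<^sup>2 \<le> \<beta>\<^sup>2" "\<beta>\<^sup>2 \<le> 2.3375\<^sup>2" unfolding \<beta>2 by (simp_all add: power2_eq_square)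
    then show "2.3374 \<le> \<beta>" "\<beta> \<le> 2.3375" using \<beta>_pos by (auto intro: power2_le_imp_le)
  qed
  have q: "2.59 \<le> q" "q \<le> 2.591"
    using \<beta> \<beta>_pos by (simp_all add: q_def \<alpha> field_simps)
  have "0.943 \<le> (\<beta> / 2) powr (- (3/8))"
    by (rule powr_neg_three_eighths_bounds(1)[where X = "2.3375 / 2"])
       (use \<beta> \<beta>_pos in \<open>simp_all add: power_divide\<close>)
  then have K_lo: "40 / 9 * 0.943 \<le> K" by (simp add: K_def)
  have "(\<beta> / 2) powr (- (3/8)) \<le> 0.9434"
    by (rule powr_neg_three_eighths_bounds(2)[where X = "2.3374 / 2"])
       (use \<beta> \<beta>_pos in \<open>simp_all add: power_divide\<close>)
  then have K_up: "K \<le> 40 / 9 * 0.9434" by (simp add: K_def)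
  \<comment> \<open>The kernel is nearly constant for small \<open>y\<close>, where
    \<open>q * y^8\<close> is tiny; hence one long first interval and denser nodes towards 1. Here
    \<open>b\<close> is the base at the right end point rounded up and \<open>k\<close> is
    \<open>b powr (-3/8)\<close> rounded down; in \<open>?up\<close> the base is taken at the left
    end point and both roundings are reversed.\<close>
  let ?lo = "[(0.48, 1.008, 0.997), (0.55, 1.022, 0.991), (0.59, 1.039, 0.985), (0.62, 1.058, 0.979), (0.65, 1.084,
    0.97), (0.67, 1.107, 0.962), (0.69, 1.136, 0.953), (0.7, 1.153, 0.948), (0.72, 1.193, 0.935), (0.74,
    1.242, 0.921), (0.75, 1.27, 0.914), (0.76, 1.301, 0.906), (0.77, 1.336, 0.897), (0.79, 1.417, 0.877),
    (0.8, 1.463, 0.867), (0.81, 1.515, 0.855), (0.82, 1.572, 0.843), (0.83, 1.635, 0.831), (0.84, 1.704,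
    0.818), (0.85, 1.781, 0.805), (0.86, 1.865, 0.791), (0.87, 1.959, 0.777), (0.88, 2.062, 0.762), (0.89,
    2.175, 0.747), (0.9, 2.301, 0.731), (0.91, 2.44, 0.715), (0.92, 2.594, 0.699), (0.93, 2.764, 0.683),
    (0.94, 2.951, 0.666), (0.95, 3.16, 0.649), (0.96, 3.39, 0.632), (0.97, 3.645, 0.615), (0.98, 3.929,
    0.598), (0.99, 4.243, 0.581), (1, 4.591, 0.564)] :: (real \<times> real \<times> real) list"
  have cert_lo: "certified_lower 2.591 0 ?lo" by (simp add: power_divide)
  have sum_lo: "0.834 \<le> cubic_sum 0 ?lo" by (simp add: power_divide)
  have \<Psi>_lo: "0.834 \<le> \<Psi> 1"
    using order_trans[OF sum_lo cubic_sum_le_\<Psi>[OF cert_lo q(2) order_refl]] by (simp only: \<Psi>_0 diff_zero)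
  let ?up = "[(0.6, 1, 1), (0.68, 1.043, 0.985), (0.74, 1.12, 0.959), (0.78, 1.24, 0.923), (0.81, 1.373, 0.888),
    (0.84, 1.514, 0.856), (0.86, 1.703, 0.82), (0.88, 1.864, 0.792), (0.9, 2.06, 0.763), (0.92, 2.3, 0.732),
    (0.94, 2.592, 0.7), (0.96, 2.95, 0.667), (0.98, 3.388, 0.633), (1, 3.927, 0.599)] :: (real \<times> real \<times> real) list"
  have cert_up: "certified_upper 2.59 0 ?up" by (simp add: power_divide)
  have sum_up: "cubic_sum 0 ?up \<le> 0.855" by (simp add: power_divide)
  have \<Psi>_up: "\<Psi> 1 \<le> 0.855"
    using order_trans[OF \<Psi>_le_cubic_sum[OF cert_up _ q(1) order_refl] sum_up] by (simp add: \<Psi>_0)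
  \<comment> \<open>Twice these products, above 6.99 and below 7.17, clear the two prescribed
    ends.\<close>
  have "40 / 9 * 0.943 * 0.834 \<le> \<omega>" "\<omega> \<le> 40 / 9 * 0.9434 * 0.855"
    unfolding \<omega>_def using K_lo K_up \<Psi>_lo \<Psi>_up K_pos by (intro mult_mono; simp)+
  then show ?thesis by simp
qed

theorem mainTheorem7:
  fixes m p a :: real and B :: "(real^2) set"
  assumes "m = 3/4" and "p = 1/4" and "a = 0.3"
    and B: "B = {y.
        y$1 \<in> {-1.0000000013268460 / 10^5 .. 1.0001776533279528 / 10^5} \<and>
        y$2 \<in> {-1.0177653015013772 / 10^7 .. 1.0000001326843545 / 10^7}}"
  shows "\<exists>c \<in> {-5.0 / 10^7 .. 5.0 / 10^7}. \<exists>\<xi>min \<xi>max :: real.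
    \<exists>\<phi> \<phi>0 :: real \<Rightarrow> real. \<exists>\<tau> :: real \<Rightarrow> real. \<exists>\<sigma> :: real \<Rightarrow> real^2. \<exists>P :: real^2^2.
      \<xi>min < \<xi>max \<and>
      \<phi> = (\<lambda>\<xi>. if \<xi> \<in> {\<xi>min<..<\<xi>max} then \<phi>0 \<xi> else 0) \<and>
      compacton_traveling_wave m (reaction p a) c \<phi> \<and>
      homoclinic_orbit (wave_field c a) 0 \<sigma> \<and>
      bij_betw \<tau> {\<xi>min<..<\<xi>max} UNIV \<and>
      (\<forall>\<xi>\<in>{\<xi>min<..<\<xi>max}.
         0 < \<phi>0 \<xi> \<and>
         (\<tau> has_real_derivative \<phi>0 \<xi> powr (- m)) (at \<xi>) \<and>
         \<phi>0 \<xi> = \<sigma> (\<tau> \<xi>) $ 1) \<and>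
      eigenmatrix_at (wave_field c a) 0 P \<and>
      column 1 P $ 1 \<in> {0.95792122415048908 .. 0.95792291154895415} \<and>
      column 1 P $ 2 \<in> {0.28737526087354431 .. 0.28737797983612196} \<and>
      column 2 P $ 1 \<in> {-0.95792291154868769 .. -0.95792122415055381} \<and>
      column 2 P $ 2 \<in> {0.28737526087240495 .. 0.28737797983793328} \<and>
      isolating_block (wave_field c a) ((\<lambda>y. P *v y) ` B) \<and>
      0 \<in> (\<lambda>y. P *v y) ` B \<and>
      (\<forall>t\<ge>0. \<xi>max - \<xi>min = measure lborel (supp (\<lambda>x. \<phi> (x - c * t)))) \<and>
      \<xi>max - \<xi>min \<in> {6.984582800445637 .. 7.20846810204}"
proof -
  have [simp]: "a = 3/10" using assms by simp
  interpret bistable_wave "3/10" by (rule bistable_wave_three_tenths)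
  \<comment> \<open>The scale lies in the enclosures for the first entries, up to sign, and
    \<open>0.3 * 0.957922 = 0.2873766\<close> lies in those for the second entries.\<close>
  define P where "P = eigenframe (3/10) 0.957922"
  have block: "isolating_block (wave_field 0 (3/10)) ((\<lambda>y. P *v y) ` B)"
    unfolding B P_def
    \<comment> \<open>\<open>\<eta>\<close> is just below the shortest half-side of
      \<open>B\<close>, and \<open>\<epsilon>\<close> generously above the longest. The two sides of
      \<open>small\<close> are then about \<open>6e-14\<close> and \<open>1.7e-8\<close>.\<close>
    by (rule isolating_block_wave_field[where \<eta> = "1 / 10^7" and \<epsilon> = "2 / 10^5"])
       (simp_all add: power_divide power_mult_distrib)
  have zero: "0 \<in> (\<lambda>y. P *v y) ` B"
    by (rule image_eqI[of _ _ 0]) (simp_all add: B)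
  have col: "column 1 P = vector [0.957922, 0.2873766]" "column 2 P = vector [- 0.957922, 0.2873766]"
    by (simp_all add: P_def eigenframe_column)
  show ?thesis
  proof (rule bexI[of _ 0], rule exI[of _ "- \<omega>"], rule exI[of _ \<omega>], rule exI[of _ "in_frame g"],
      rule exI[of _ "\<lambda>x. g (T x)"], rule exI[of _ T], rule exI[of _ "\<lambda>\<tau>. vector [g \<tau>, h \<tau>]"],
      rule exI[of _ P], intro conjI ballI allI impI)
    show "in_frame g = (\<lambda>\<xi>. if \<xi> \<in> {- \<omega><..<\<omega>} then g (T \<xi>) else 0)"
      by (simp add: fun_eq_iff in_frame_def)
    show "compacton_traveling_wave m (reaction p a) 0 (in_frame g)"
      unfolding assms(1,2) using compacton by simp
    show "homoclinic_orbit (wave_field 0 a) 0 (\<lambda>\<tau>. vector [g \<tau>, h \<tau>])"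
      using homoclinic by simp
    show "bij_betw T {- \<omega><..<\<omega>} UNIV" by (rule T_bij)
    show "(T has_real_derivative g (T x) powr (- m)) (at x)" if "x \<in> {- \<omega><..<\<omega>}" for x
      unfolding assms(1) using T_deriv[OF that] by simp
    show "eigenmatrix_at (wave_field 0 a) 0 P"
      using eigenmatrix_at_wave_field[of "3/10" "0.957922"] by (simp add: P_def)
    show "isolating_block (wave_field 0 a) ((\<lambda>y. P *v y) ` B)" using block by simp
    show "\<omega> - - \<omega> = measure lborel (supp (\<lambda>x. in_frame g (x - 0 * t)))" for t
      using \<omega>_pos by (simp add: supp_in_frame_g)
    show "\<omega> - - \<omega> \<in> {6.984582800445637 .. 7.20846810204}"
      using width_bounds by (simp only: diff_minus_eq_add mult_2)
  qed (use \<omega>_pos g_pos zero in \<open>simp_all add: col\<close>)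
qed

end
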